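(* Let $R\subseteq S$ be an étale ring extension. (1) $R\subseteq S$ has FIP, is seminormal and is finite if and only if its nucleus $R/(R:S)$ is Artinian and reduced. (2) $R\subseteq S$ has FIP, is finite and has reduced nucleus if and only if $R\subseteq S$ is a seminormal Gilmer extension.
   Context: Rings are commutative with identity. Étale: flat, of finite presentation, unramified. $(R:S)=\{r\in R\mid rS\subseteq R\}$, nucleus $R/(R:S)$; Gilmer extension: nucleus Artinian. Seminormal: $b\in S$, $b^2,b^3\in R$ imply $b\in R$. FIP: finitely many $R$-subalgebras. *)

theory Defs
  imports Main "HOL-Library.Poly_Mapping"
begin

text \<open>Setting: the ring extension is R \<subseteq> S where S is the whole (commutative) type 'a
  and R is a subring of it.\<close>

definition is_subring :: "'a::comm_ring_1 set \<Rightarrow> bool" where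
  "is_subring R \<longleftrightarrow> 0 \<in> R \<and> 1 \<in> R \<and> (\<forall>x\<in>R. \<forall>y\<in>R. x + y \<in> R \<and> x - y \<in> R \<and> x * y \<in> R)"

definition ideal_of :: "'a::comm_ring_1 set \<Rightarrow> 'a set \<Rightarrow> bool" where
  "ideal_of R J \<longleftrightarrow> J \<subseteq> R \<and> 0 \<in> J \<and> (\<forall>x\<in>J. \<forall>y\<in>J. x + y \<in> J \<and> x - y \<in> J)
     \<and> (\<forall>r\<in>R. \<forall>x\<in>J. r * x \<in> J)"

definition conductor :: "'a::comm_ring_1 set \<Rightarrow> 'a set" where
  "conductor R = {r \<in> R. \<forall>s. r * s \<in> R}"

text \<open>R/I is Artinian: DCC on ideals of R/I, i.e. (correspondence theorem) on ideals of R containing I.\<close>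
definition artinian_quotient :: "'a::comm_ring_1 set \<Rightarrow> 'a set \<Rightarrow> bool" where
  "artinian_quotient R I \<longleftrightarrow>
     (\<forall>f :: nat \<Rightarrow> 'a set. (\<forall>n. ideal_of R (f n) \<and> I \<subseteq> f n \<and> f (Suc n) \<subseteq> f n)
        \<longrightarrow> (\<exists>N. \<forall>n\<ge>N. f n = f N))"

definition reduced_quotient :: "'a::comm_ring_1 set \<Rightarrow> 'a set \<Rightarrow> bool" where
  "reduced_quotient R I \<longleftrightarrow> (\<forall>r\<in>R. \<forall>n::nat. n > 0 \<longrightarrow> r ^ n \<in> I \<longrightarrow> r \<in> I)"

definition nucleus_artinian :: "'a::comm_ring_1 set \<Rightarrow> bool" where
  "nucleus_artinian R \<longleftrightarrow> artinian_quotient R (conductor R)"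

definition nucleus_reduced :: "'a::comm_ring_1 set \<Rightarrow> bool" where
  "nucleus_reduced R \<longleftrightarrow> reduced_quotient R (conductor R)"

definition gilmer_ext :: "'a::comm_ring_1 set \<Rightarrow> bool" where
  "gilmer_ext R \<longleftrightarrow> nucleus_artinian R"

definition fip_ext :: "'a::comm_ring_1 set \<Rightarrow> bool" where
  "fip_ext R \<longleftrightarrow> finite {T. is_subring T \<and> R \<subseteq> T}"

definition seminormal_ext :: "'a::comm_ring_1 set \<Rightarrow> bool" where
  "seminormal_ext R \<longleftrightarrow> (\<forall>b. b ^ 2 \<in> R \<and> b ^ 3 \<in> R \<longrightarrow> b \<in> R)"

definition finite_ext :: "'a::comm_ring_1 set \<Rightarrow> bool" where
  "finite_ext R \<longleftrightarrow> (\<exists>F. finite F \<and> (\<forall>s. \<exists>c. (\<forall>x\<in>F. c x \<in> R) \<and> s = (\<Sum>x\<in>F. c x * x)))"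

text \<open>Flatness of S over R (equational criterion of flatness).\<close>
definition flat_ext :: "'a::comm_ring_1 set \<Rightarrow> bool" where
  "flat_ext R \<longleftrightarrow>
    (\<forall>(n::nat) (r::nat \<Rightarrow> 'a) (x::nat \<Rightarrow> 'a).
       (\<forall>i<n. r i \<in> R) \<and> (\<Sum>i<n. r i * x i) = 0 \<longrightarrow>
       (\<exists>(m::nat) (a::nat \<Rightarrow> nat \<Rightarrow> 'a) (y::nat \<Rightarrow> 'a).
          (\<forall>i<n. \<forall>j<m. a i j \<in> R) \<and>
          (\<forall>i<n. x i = (\<Sum>j<m. a i j * y j)) \<and>
          (\<forall>j<m. (\<Sum>i<n. r i * a i j) = 0)))"

text \<open>Multivariate polynomials in variables X_0, X_1, ...: finitely supported maps from
  monomials (exponent vectors) to coefficients.\<close>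
type_synonym 'a mpoly = "(nat \<Rightarrow>\<^sub>0 nat) \<Rightarrow>\<^sub>0 'a"

definition mpoly_eval :: "(nat \<Rightarrow> 'a::comm_ring_1) \<Rightarrow> 'a mpoly \<Rightarrow> 'a" where
  "mpoly_eval s p = (\<Sum>m\<in>Poly_Mapping.keys p. Poly_Mapping.lookup p m * (\<Prod>i\<in>Poly_Mapping.keys m. s i ^ Poly_Mapping.lookup m (i::nat)))"

definition polys_over :: "'a::comm_ring_1 set \<Rightarrow> nat \<Rightarrow> 'a mpoly set" where
  "polys_over R n = {p. (\<forall>m. Poly_Mapping.lookup p m \<in> R) \<and> (\<forall>m\<in>Poly_Mapping.keys p. \<forall>i\<in>Poly_Mapping.keys m. i < n)}"

text \<open>Finite presentation: S \<cong> R[X_0,..,X_{n-1}]/J with J finitely generated; i.e. the evaluation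
  map at some s_0..s_{n-1} is surjective and its kernel is a finitely generated ideal.\<close>
definition fin_pres_ext :: "'a::comm_ring_1 set \<Rightarrow> bool" where
  "fin_pres_ext R \<longleftrightarrow>
    (\<exists>(n::nat) (s::nat \<Rightarrow> 'a).
       (\<forall>t. \<exists>p\<in>polys_over R n. mpoly_eval s p = t) \<and>
       (\<exists>F. finite F \<and> F \<subseteq> {p\<in>polys_over R n. mpoly_eval s p = 0} \<and>
            (\<forall>p\<in>polys_over R n. mpoly_eval s p = 0 \<longrightarrow>
               (\<exists>g. (\<forall>f\<in>F. g f \<in> polys_over R n) \<and> p = (\<Sum>f\<in>F. g f * f)))))"

text \<open>Kaehler differentials: Omega_{S/R} is the free S-module on symbols d s (represented as
  finitely supported maps from S to S; single x c stands for c times d x) modulo the S-submodule generated by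
  d(x+y) - dx - dy, d(xy) - x dy - y dx, and d r for r \<in> R.\<close>
inductive_set kahler_relations :: "'a::comm_ring_1 set \<Rightarrow> ('a \<Rightarrow>\<^sub>0 'a) set" for R where
  zero: "0 \<in> kahler_relations R"
| add_rel: "v \<in> kahler_relations R \<Longrightarrow>
     Poly_Mapping.single (x + y) c - Poly_Mapping.single x c - Poly_Mapping.single y c + v \<in> kahler_relations R"
| mult_rel: "v \<in> kahler_relations R \<Longrightarrow>
     Poly_Mapping.single (x * y) c - Poly_Mapping.single y (c * x) - Poly_Mapping.single x (c * y) + v
       \<in> kahler_relations R"
| const_rel: "r \<in> R \<Longrightarrow> v \<in> kahler_relations R \<Longrightarrow> Poly_Mapping.single r c + v \<in> kahler_relations R"

text \<open>Unramified: Omega_{S/R} = 0 (and finite type, implied by finite presentation below).\<close>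
definition unramified_ext :: "'a::comm_ring_1 set \<Rightarrow> bool" where
  "unramified_ext R \<longleftrightarrow> (\<forall>s. Poly_Mapping.single s 1 \<in> kahler_relations R)"

definition etale_ext :: "'a::comm_ring_1 set \<Rightarrow> bool" where
  "etale_ext R \<longleftrightarrow> flat_ext R \<and> fin_pres_ext R \<and> unramified_ext R"

end

theory Submission
  imports Defs
begin

text \<open>
  Put \<open>I = (R : S)\<close>, \<open>K = R/I\<close> and \<open>A = S/I\<close>. Seminormality makes \<open>I\<close> a radical ideal. If the
  extension has FIP, is finite and has reduced nucleus, then for \<open>a \<in> R\<close> the rings \<open>R + a\<^sup>n S\<close> stabilise, so
  Nakayama's lemma shows that \<open>K\<close> is von Neumann regular; an ideal of \<open>K\<close> is then determined by the finite
  set of rings \<open>R + a S\<close> with \<open>a\<close> in the ideal, hence \<open>K\<close> is Artinian.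

  Conversely let \<open>K\<close> be Artinian and reduced, so that each of its ideals is generated by an idempotent and
  all \<open>K\<close>-modules are semisimple. Since the differentials vanish and \<open>S\<close> is finitely generated,
  Nakayama's lemma produces a separability element of \<open>A \<otimes>\<^sub>K A\<close>. Averaging a \<open>K\<close>-linear projection onto an
  ideal of \<open>A\<close> with it makes the projection \<open>A\<close>-linear, so every ideal of \<open>A\<close> is generated by an
  idempotent; averaging a projection onto a finitely generated submodule shows that \<open>A\<close> is finite over \<open>K\<close>.
  Base change of the separability element gives the same for \<open>A \<otimes>\<^sub>K A\<close>, which therefore has finitely
  many ideals. An intermediate ring \<open>T\<close> is recovered from the kernel of \<open>A \<otimes>\<^sub>K A \<rightarrow> A \<otimes>\<^sub>T A\<close> by
  means of a \<open>T\<close>-linear projection onto \<open>T\<close>, and FIP follows.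

  Quotients are not formed: everything is stated for elements of \<open>S\<close> modulo \<open>I\<close>.
\<close>

section \<open>Submodules, Nakayama's lemma and projections\<close>

text \<open>The scalars \<open>R\<close> are any subset of the ambient ring:
  \<open>submodule UNIV\<close> means an ideal of that ring. The ambient ring is \<open>S\<close> at
  first, later also the algebra of tensors.\<close>

definition submodule :: "'a::comm_ring_1 set \<Rightarrow> 'a set \<Rightarrow> bool" where
  "submodule R J \<longleftrightarrow> 0 \<in> J \<and> (\<forall>x\<in>J. \<forall>y\<in>J. x + y \<in> J \<and> x - y \<in> J) \<and> (\<forall>r\<in>R. \<forall>x\<in>J. r * x \<in> J)"

lemma ideal_of_iff: "ideal_of R J \<longleftrightarrow> submodule R J \<and> J \<subseteq> R"
  by (auto simp: ideal_of_def submodule_def)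

lemma submodule_0: "submodule R J \<Longrightarrow> 0 \<in> J"
  and submodule_add: "submodule R J \<Longrightarrow> x \<in> J \<Longrightarrow> y \<in> J \<Longrightarrow> x + y \<in> J"
  and submodule_diff: "submodule R J \<Longrightarrow> x \<in> J \<Longrightarrow> y \<in> J \<Longrightarrow> x - y \<in> J"
  and submodule_mult: "submodule R J \<Longrightarrow> r \<in> R \<Longrightarrow> x \<in> J \<Longrightarrow> r * x \<in> J"
  by (auto simp: submodule_def)

lemma submodule_mult_right: "submodule R J \<Longrightarrow> r \<in> R \<Longrightarrow> x \<in> J \<Longrightarrow> x * r \<in> J"
  by (metis submodule_mult mult.commute)

lemma submodule_uminus: "submodule R J \<Longrightarrow> x \<in> J \<Longrightarrow> - x \<in> J"
  using submodule_diff[of R J 0 x] submodule_0 by auto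

lemma submodule_sum: "submodule R J \<Longrightarrow> (\<And>i. i \<in> F \<Longrightarrow> g i \<in> J) \<Longrightarrow> sum g F \<in> J"
  by (induction F rule: infinite_finite_induct) (auto intro: submodule_0 submodule_add)

lemma submodule_antimono: "submodule R J \<Longrightarrow> T \<subseteq> R \<Longrightarrow> submodule T J"
  by (auto simp: submodule_def)

lemma submodule_subring: "is_subring R \<Longrightarrow> submodule R R"
  by (auto simp: submodule_def is_subring_def)

lemma subring_0: "is_subring R \<Longrightarrow> 0 \<in> R"
  and subring_1: "is_subring R \<Longrightarrow> 1 \<in> R"
  and subring_add: "is_subring R \<Longrightarrow> x \<in> R \<Longrightarrow> y \<in> R \<Longrightarrow> x + y \<in> R"
  and subring_diff: "is_subring R \<Longrightarrow> x \<in> R \<Longrightarrow> y \<in> R \<Longrightarrow> x - y \<in> R"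
  and subring_mult: "is_subring R \<Longrightarrow> x \<in> R \<Longrightarrow> y \<in> R \<Longrightarrow> x * y \<in> R"
  by (auto simp: is_subring_def)

lemma subring_power: "is_subring R \<Longrightarrow> x \<in> R \<Longrightarrow> x ^ n \<in> R"
  by (induction n) (auto simp: subring_1 subring_mult)

lemma subring_UNIV: "is_subring UNIV"
  by (auto simp: is_subring_def)

lemma submodule_trans:
  assumes "submodule R J" "x - y \<in> J" "y - z \<in> J"
  shows "x - z \<in> J"
  using submodule_add[OF assms] by simp

lemma submodule_sym:
  assumes "submodule R J" "x - y \<in> J"
  shows "y - x \<in> J"
  using submodule_uminus[OF assms] by simp

lemma submodule_mem_cong:
  assumes "submodule R J" "x - y \<in> J" "y \<in> J"
  shows "x \<in> J"
  using submodule_add[OF assms] by simp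

lemma submodule_adjoin:
  assumes R: "is_subring R" and Q: "submodule R Q"
  shows "submodule R {q + r * x | q r. q \<in> Q \<and> r \<in> R}"
  unfolding submodule_def
proof (intro conjI ballI)
  show "0 \<in> {q + r * x | q r. q \<in> Q \<and> r \<in> R}"
    using subring_0[OF R] submodule_0[OF Q] by (force intro!: exI[of _ 0])
next
  fix y z assume "y \<in> {q + r * x | q r. q \<in> Q \<and> r \<in> R}" "z \<in> {q + r * x | q r. q \<in> Q \<and> r \<in> R}"
  then obtain q r q' r' where *: "y = q + r * x" "z = q' + r' * x" "q \<in> Q" "r \<in> R" "q' \<in> Q" "r' \<in> R"
    by blast
  have "y + z = (q + q') + (r + r') * x" "y - z = (q - q') + (r - r') * x"
    using * by (simp_all add: algebra_simps)
  then show "y + z \<in> {q + r * x | q r. q \<in> Q \<and> r \<in> R}" "y - z \<in> {q + r * x | q r. q \<in> Q \<and> r \<in> R}"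
    using * R Q subring_add subring_diff submodule_add submodule_diff by blast+
next
  fix s y assume "s \<in> R" "y \<in> {q + r * x | q r. q \<in> Q \<and> r \<in> R}"
  then obtain q r where *: "y = q + r * x" "q \<in> Q" "r \<in> R"
    by blast
  have "s * y = s * q + (s * r) * x"
    using * by (simp add: algebra_simps)
  then show "s * y \<in> {q + r * x | q r. q \<in> Q \<and> r \<in> R}"
    using * \<open>s \<in> R\<close> R Q subring_mult submodule_mult by blast
qed

text \<open>Generators are eliminated one at a time. Each relation carries its own factor
  \<open>u\<close> congruent to 1 modulo \<open>A\<close>, because substituting one relation into
  another creates such factors.\<close>

lemma nakayama:
  assumes R: "is_subring R" and A: "submodule R A" "A \<subseteq> R" and P: "submodule R P"
    and F: "finite F"
    and gen: "\<And>i. i \<in> F \<Longrightarrow> \<exists>u c. 1 - u \<in> A \<and> (\<forall>j\<in>F. c j \<in> A) \<and> u * g i - (\<Sum>j\<in>F. c j * g j) \<in> P"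
  shows "\<exists>u. 1 - u \<in> A \<and> (\<forall>i\<in>F. u * g i \<in> P)"
  using F gen
proof (induction F rule: finite_induct)
  case empty
  show ?case
    using submodule_0[OF A(1)] by (intro exI[of _ 1]) simp
next
  case (insert k F)
  have unit_in: "u \<in> R" if "1 - u \<in> A" for u
    using subring_diff[OF R subring_1[OF R], of "1 - u"] that A(2) by auto
  have unit_mult: "1 - u * v \<in> A" if "1 - u \<in> A" "1 - v \<in> A" for u v
  proof -
    have "1 - u * v = (1 - u) + u * (1 - v)" by (simp add: algebra_simps)
    then show ?thesis
      using that A unit_in by (metis submodule_add submodule_mult)
  qed
  obtain u c where u: "1 - u \<in> A" and c: "\<forall>j\<in>insert k F. c j \<in> A"
    and uc: "u * g k - (\<Sum>j\<in>insert k F. c j * g j) \<in> P"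
    using insert.prems[of k] by auto
  \<comment> \<open>Moving \<open>c k * g k\<close> to the left solves the relation of
    \<open>k\<close> for \<open>g k\<close>, up to the factor \<open>v\<close>.\<close>
  define v where "v = u - c k"
  have v: "1 - v \<in> A"
    using submodule_add[OF A(1) u, of "c k"] c by (simp add: v_def algebra_simps)
  have vk: "v * g k - (\<Sum>j\<in>F. c j * g j) \<in> P"
    using uc insert.hyps by (simp add: v_def algebra_simps)
  have "\<exists>u. 1 - u \<in> A \<and> (\<forall>i\<in>F. u * g i \<in> P)"
  proof (rule insert.IH)
    fix i assume i: "i \<in> F"
    obtain w d where w: "1 - w \<in> A" and d: "\<forall>j\<in>insert k F. d j \<in> A"
      and wd: "w * g i - (\<Sum>j\<in>insert k F. d j * g j) \<in> P"
      using insert.prems[of i] i by auto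
    \<comment> \<open>Substituting for \<open>v * g k\<close> removes \<open>g k\<close> from the
      relation of \<open>i\<close>.\<close>
    have "v * (w * g i - (\<Sum>j\<in>insert k F. d j * g j)) + d k * (v * g k - (\<Sum>j\<in>F. c j * g j)) \<in> P"
      using wd vk P v unit_in d A(2) by (intro submodule_add[OF P] submodule_mult[OF P]) auto
    also have "v * (w * g i - (\<Sum>j\<in>insert k F. d j * g j)) + d k * (v * g k - (\<Sum>j\<in>F. c j * g j))
        = (v * w) * g i - (\<Sum>j\<in>F. (v * d j + d k * c j) * g j)"
      using insert.hyps by (simp add: algebra_simps sum.distrib sum_distrib_left)
    finally have "(v * w) * g i - (\<Sum>j\<in>F. (v * d j + d k * c j) * g j) \<in> P" .
    moreover have "v * d j + d k * c j \<in> A" if "j \<in> F" for j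
      using that c d v unit_in A by (auto intro!: submodule_add[OF A(1)] submodule_mult[OF A(1)])
    ultimately show "\<exists>u c. 1 - u \<in> A \<and> (\<forall>j\<in>F. c j \<in> A) \<and> u * g i - (\<Sum>j\<in>F. c j * g j) \<in> P"
      using unit_mult[OF v w] by (intro exI[of _ "v * w"] exI[of _ "\<lambda>j. v * d j + d k * c j"]) auto
  qed
  then obtain w where w: "1 - w \<in> A" "\<forall>i\<in>F. w * g i \<in> P"
    by blast
  have "(\<Sum>j\<in>F. c j * (w * g j)) \<in> P"
    by (rule submodule_sum[OF P], rule submodule_mult[OF P]) (use w c A(2) in auto)
  then have "w * (v * g k - (\<Sum>j\<in>F. c j * g j)) + (\<Sum>j\<in>F. c j * (w * g j)) \<in> P"
    using submodule_add[OF P submodule_mult[OF P unit_in[OF w(1)] vk]] by blast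
  then have "(w * v) * g k \<in> P"
    by (simp add: algebra_simps sum_distrib_left)
  moreover have "(w * v) * g i \<in> P" if "i \<in> F" for i
    using submodule_mult[OF P unit_in[OF v], of "w * g i"] w that by (simp add: algebra_simps)
  ultimately show ?case
    using unit_mult[OF w(1) v] by (intro exI[of _ "w * v"]) auto
qed

text \<open>Taking \<open>p = e\<close> shows that \<open>e\<close> is idempotent modulo
  \<open>I\<close>. So every ideal of \<open>R/I\<close> is generated by an idempotent, which for a
  commutative ring is semisimplicity.\<close>

definition semisimple_mod :: "'a::comm_ring_1 set \<Rightarrow> 'a set \<Rightarrow> bool" where
  "semisimple_mod R I \<longleftrightarrow> (\<forall>P. submodule R P \<and> P \<subseteq> R \<and> I \<subseteq> P \<longrightarrow> (\<exists>e\<in>P. \<forall>p\<in>P. p - p * e \<in> I))"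

text \<open>Von Neumann regularity of \<open>R/I\<close>, with \<open>b\<close> a quasi-inverse of
  \<open>a\<close>.\<close>

definition regular_mod :: "'a::comm_ring_1 set \<Rightarrow> 'a set \<Rightarrow> bool" where
  "regular_mod R I \<longleftrightarrow> (\<forall>a\<in>R. \<exists>b\<in>R. a - a * a * b \<in> I)"

definition linear_mod :: "'a::comm_ring_1 set \<Rightarrow> 'a set \<Rightarrow> ('a \<Rightarrow> 'a) \<Rightarrow> bool" where
  "linear_mod R I \<phi> \<longleftrightarrow> (\<forall>x y. \<phi> (x + y) - (\<phi> x + \<phi> y) \<in> I) \<and> (\<forall>r\<in>R. \<forall>x. \<phi> (r * x) - r * \<phi> x \<in> I)"

text \<open>Zorn's lemma gives \<open>Q\<close> maximal with \<open>Q \<inter> J = I\<close>. If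
  some \<open>x\<close> were outside \<open>Q + J\<close>, semisimplicity would provide a multiple
  of \<open>x\<close> that can still be adjoined to \<open>Q\<close>.\<close>

lemma complement_exists:
  assumes R: "is_subring R" and I: "submodule UNIV I" "I \<subseteq> R" and ss: "semisimple_mod R I"
    and J: "submodule R J" "I \<subseteq> J"
  obtains Q where "submodule R Q" "Q \<inter> J = I" "\<And>x. \<exists>y\<in>J. x - y \<in> Q"
proof -
  define A where "A = {Q. submodule R Q \<and> Q \<inter> J = I}"
  have "I \<in> A"
    using I J by (auto simp: A_def intro: submodule_antimono)
  have "\<exists>M\<in>A. \<forall>X\<in>A. M \<subseteq> X \<longrightarrow> X = M"
  proof (rule subset_Zorn_nonempty)
    show "A \<noteq> {}" using \<open>I \<in> A\<close> by auto
    fix C assume C: "C \<noteq> {}" "subset.chain A C"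
    then have sub: "\<And>Q. Q \<in> C \<Longrightarrow> submodule R Q" and int: "\<And>Q. Q \<in> C \<Longrightarrow> Q \<inter> J = I"
      by (auto simp: A_def subset_chain_def)
    have two: "\<exists>Q\<in>C. x \<in> Q \<and> y \<in> Q" if "x \<in> \<Union>C" "y \<in> \<Union>C" for x y
      using that C(2) unfolding subset_chain_def by blast
    have "submodule R (\<Union>C)"
      unfolding submodule_def
    proof (intro conjI ballI)
      show "0 \<in> \<Union>C" using C(1) sub submodule_0 by blast
      show "x + y \<in> \<Union>C" "x - y \<in> \<Union>C" if "x \<in> \<Union>C" "y \<in> \<Union>C" for x y
        using two[OF that] sub submodule_add submodule_diff by blast+
      show "r * x \<in> \<Union>C" if "r \<in> R" "x \<in> \<Union>C" for r x
        using that sub submodule_mult by blast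
    qed
    moreover have "\<Union>C \<inter> J = I"
      using int C(1) by blast
    ultimately show "\<Union>C \<in> A" by (simp add: A_def)
  qed
  then obtain Q where Q: "submodule R Q" "Q \<inter> J = I" and max: "\<And>X. X \<in> A \<Longrightarrow> Q \<subseteq> X \<Longrightarrow> X = Q"
    by (auto simp: A_def)
  have "\<exists>y\<in>J. x - y \<in> Q" for x
  proof -
    \<comment> \<open>The scalars carrying \<open>x\<close> into \<open>Q + J\<close>; their
      idempotent \<open>e\<close> splits \<open>x\<close> as
      \<open>e * x + (1 - e) * x\<close>.\<close>
    define P where "P = {r \<in> R. \<exists>y\<in>J. r * x - y \<in> Q}"
    have "submodule R P"
      unfolding submodule_def
    proof (intro conjI ballI)
      show "0 \<in> P"
        using subring_0[OF R] submodule_0[OF J(1)] submodule_0[OF Q(1)] by (force simp: P_def)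
    next
      fix a b assume "a \<in> P" "b \<in> P"
      then obtain y z where *: "a \<in> R" "b \<in> R" "y \<in> J" "z \<in> J" "a * x - y \<in> Q" "b * x - z \<in> Q"
        by (auto simp: P_def)
      have "(a + b) * x - (y + z) \<in> Q" "(a - b) * x - (y - z) \<in> Q"
        using submodule_add[OF Q(1) *(5,6)] submodule_diff[OF Q(1) *(5,6)] by (simp_all add: algebra_simps)
      then show "a + b \<in> P" "a - b \<in> P"
        using * R J by (auto simp: P_def intro: subring_add subring_diff submodule_add submodule_diff)
    next
      fix r a assume "r \<in> R" "a \<in> P"
      then obtain y where *: "a \<in> R" "y \<in> J" "a * x - y \<in> Q"
        by (auto simp: P_def)
      have "r * a * x - r * y \<in> Q"
        using submodule_mult[OF Q(1) \<open>r \<in> R\<close> *(3)] by (simp add: algebra_simps)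
      then show "r * a \<in> P"
        using * R J \<open>r \<in> R\<close> by (auto simp: P_def intro: subring_mult submodule_mult)
    qed
    moreover have "P \<subseteq> R" by (auto simp: P_def)
    moreover have "I \<subseteq> P"
    proof
      fix i assume i: "i \<in> I"
      then have "i * x \<in> J" using I J(2) submodule_mult_right by blast
      then show "i \<in> P" using i I(2) submodule_0[OF Q(1)] by (force simp: P_def)
    qed
    ultimately obtain e where e: "e \<in> P" "\<And>p. p \<in> P \<Longrightarrow> p - p * e \<in> I"
      using ss unfolding semisimple_mod_def by blast
    then obtain y where y: "e \<in> R" "y \<in> J" "e * x - y \<in> Q" by (auto simp: P_def)
    define x' where "x' = (1 - e) * x"
    \<comment> \<open>If \<open>r * x'\<close> lies in \<open>Q + J\<close>, then
      \<open>r * (1 - e)\<close> is in \<open>P\<close>, hence congruent to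
      \<open>r * (1 - e) * e\<close>, which is in \<open>I\<close>. So adjoining \<open>x'\<close>
      keeps the intersection at \<open>I\<close>.\<close>
    define Q' where "Q' = {q + r * x' | q r. q \<in> Q \<and> r \<in> R}"
    have "submodule R Q'"
      unfolding Q'_def by (rule submodule_adjoin[OF R Q(1)])
    moreover have "Q' \<inter> J \<subseteq> I"
    proof
      fix z assume "z \<in> Q' \<inter> J"
      then obtain q r where z: "z = q + r * x'" "q \<in> Q" "r \<in> R" "z \<in> J"
        by (auto simp: Q'_def)
      have "r * (1 - e) * x - z \<in> Q"
        using z submodule_uminus[OF Q(1), of q] by (simp add: x'_def algebra_simps)
      then have rP: "r * (1 - e) \<in> P"
        using z y R by (auto simp: P_def intro!: subring_mult subring_diff subring_1)
      have "r * (1 - e) - r * (1 - e) * e \<in> I" by (rule e(2)[OF rP])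
      moreover have "r * (e - e * e) \<in> I"
        using e submodule_mult[OF I(1)] by auto
      ultimately have "r * (1 - e) - r * (1 - e) * e + r * (e - e * e) \<in> I"
        by (rule submodule_add[OF I(1)])
      then have "r * (1 - e) \<in> I"
        using \<open>r * (e - e * e) \<in> I\<close> by (simp add: algebra_simps)
      then have "r * (1 - e) * x \<in> I" by (rule submodule_mult_right[OF I(1) UNIV_I])
      then have rx: "r * x' \<in> I" by (simp add: x'_def mult.assoc)
      then have "z - r * x' \<in> J" using J z submodule_diff by blast
      then have "q \<in> I" using z Q by auto
      then show "z \<in> I" using rx z submodule_add[OF I(1)] by auto
    qed
    moreover have QQ': "Q \<subseteq> Q'"
    proof
      fix q assume "q \<in> Q"
      then show "q \<in> Q'" using subring_0[OF R] by (force simp: Q'_def)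
    qed
    ultimately have "Q' \<in> A" using Q by (auto simp: A_def)
    then have "Q' = Q" using max QQ' by blast
    moreover have "x' \<in> Q'"
      unfolding Q'_def using submodule_0[OF Q(1)] subring_1[OF R] by force
    ultimately have "x' \<in> Q" by simp
    then have "x' + (e * x - y) \<in> Q" using y submodule_add[OF Q(1)] by blast
    then have "x - y \<in> Q" by (simp add: x'_def algebra_simps)
    then show ?thesis using y by blast
  qed
  then show ?thesis using Q that by blast
qed

text \<open>The component in \<open>J\<close> along a complement \<open>Q\<close> is unique modulo
  \<open>Q \<inter> J = I\<close>, so any choice of it is linear modulo \<open>I\<close>.\<close>

lemma linear_projection_exists:
  assumes R: "is_subring R" and I: "submodule UNIV I" "I \<subseteq> R" and ss: "semisimple_mod R I"
    and J: "submodule R J" "I \<subseteq> J"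
  obtains \<phi> where "linear_mod R I \<phi>" "\<And>x. \<phi> x \<in> J" "\<And>x. x \<in> J \<Longrightarrow> \<phi> x - x \<in> I"
proof -
  obtain Q where Q: "submodule R Q" "Q \<inter> J = I" "\<And>x. \<exists>y\<in>J. x - y \<in> Q"
    using complement_exists[OF assms] by blast
  define \<phi> where "\<phi> x = (SOME y. y \<in> J \<and> x - y \<in> Q)" for x
  have \<phi>: "\<phi> x \<in> J" "x - \<phi> x \<in> Q" for x
    using someI_ex[of "\<lambda>y. y \<in> J \<and> x - y \<in> Q"] Q(3)[of x] by (auto simp: \<phi>_def)
  have key: "y \<in> I" if "y \<in> J" "y \<in> Q" for y
    using that Q(2) by blast
  have add: "\<phi> (x + y) - (\<phi> x + \<phi> y) \<in> I" for x y
  proof (rule key)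
    show "\<phi> (x + y) - (\<phi> x + \<phi> y) \<in> J"
      by (intro submodule_diff[OF J(1)] submodule_add[OF J(1)] \<phi>)
    have "(x - \<phi> x) + (y - \<phi> y) - (x + y - \<phi> (x + y)) \<in> Q"
      by (intro submodule_diff[OF Q(1)] submodule_add[OF Q(1)] \<phi>)
    then show "\<phi> (x + y) - (\<phi> x + \<phi> y) \<in> Q" by (simp add: algebra_simps)
  qed
  have mult: "\<phi> (r * x) - r * \<phi> x \<in> I" if "r \<in> R" for r x
  proof (rule key)
    show "\<phi> (r * x) - r * \<phi> x \<in> J"
      by (intro submodule_diff[OF J(1)] submodule_mult[OF J(1)] \<phi> that)
    have "r * (x - \<phi> x) - (r * x - \<phi> (r * x)) \<in> Q"
      by (intro submodule_diff[OF Q(1)] submodule_mult[OF Q(1)] \<phi> that)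
    then show "\<phi> (r * x) - r * \<phi> x \<in> Q" by (simp add: algebra_simps)
  qed
  have id: "\<phi> x - x \<in> I" if "x \<in> J" for x
  proof (rule key)
    show "\<phi> x - x \<in> J" using that by (intro submodule_diff[OF J(1)] \<phi>)
    show "\<phi> x - x \<in> Q" using submodule_uminus[OF Q(1) \<phi>(2)[of x]] by simp
  qed
  show ?thesis
    using add mult id \<phi> by (intro that[of \<phi>]) (auto simp: linear_mod_def)
qed

section \<open>Tensor squares and separability\<close>

text \<open>
  A copy of the multiplicative monoid of a ring, written additively, so that \<open>'a tensor\<close> is
  its monoid algebra. The basis element \<open>Mul x\<close> with coefficient \<open>c\<close> stands for \<open>c \<otimes> x\<close>, and
  \<open>tensor_relations R I\<close> below is the kernel of the map to \<open>S/I \<otimes>\<^sub>R S/I\<close>.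
\<close>
datatype 'a mul = Mul (unmul: 'a)

instantiation mul :: (comm_monoid_mult) comm_monoid_add
begin

definition "0 = Mul 1"
definition "m + n = Mul (unmul m * unmul n)"

instance
  by standard (auto simp: zero_mul_def plus_mul_def ac_simps)

end

type_synonym 'a tensor = "'a mul \<Rightarrow>\<^sub>0 'a"

text \<open>Represents \<open>s \<otimes> 1\<close>, as \<open>tensor_right s\<close> represents
  \<open>1 \<otimes> s\<close>. The former is a ring homomorphism; the latter is multiplicative, but
  additive only modulo \<open>tensor_relations\<close>.\<close>

definition tensor_left :: "'a::comm_ring_1 \<Rightarrow> 'a tensor" where
  "tensor_left s = Poly_Mapping.single 0 s"

definition tensor_right :: "'a::comm_ring_1 \<Rightarrow> 'a tensor" where
  "tensor_right s = Poly_Mapping.single (Mul s) 1"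

lemma tensor_left_add: "tensor_left (x + y) = tensor_left x + tensor_left y"
  and tensor_left_diff: "tensor_left (x - y) = tensor_left x - tensor_left y"
  and tensor_left_mult: "tensor_left (x * y) = tensor_left x * tensor_left y"
  and tensor_left_0: "tensor_left 0 = 0"
  and tensor_left_1: "tensor_left 1 = 1"
  by (simp_all add: tensor_left_def single_add single_diff mult_single)

lemma tensor_right_mult: "tensor_right (x * y) = tensor_right x * tensor_right y"
  and tensor_right_1: "tensor_right 1 = 1"
  by (simp_all add: tensor_right_def mult_single plus_mul_def flip: zero_mul_def)

lemma single_eq_tensor: "Poly_Mapping.single m c = tensor_left c * tensor_right (unmul m)"
  by (simp add: tensor_left_def tensor_right_def mult_single)

section \<open>Additive extension of maps from single terms to formal sums\<close>

lemma poly_mapping_eq_sum_single: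
  "w = (\<Sum>k\<in>Poly_Mapping.keys w. Poly_Mapping.single k (Poly_Mapping.lookup w k))"
  by (rule poly_mapping_eqI)
     (simp add: lookup_sum lookup_single when_def sum.delta in_keys_iff)

lemma poly_mapping_single_induct:
  assumes "P 0" and "\<And>k c v. P v \<Longrightarrow> P (Poly_Mapping.single k c + v)"
  shows "P (w :: 'k \<Rightarrow>\<^sub>0 'a::comm_monoid_add)"
proof -
  have "P (\<Sum>k\<in>K. Poly_Mapping.single k (Poly_Mapping.lookup w k))" if "finite K" for K
    using that by (induction K rule: finite_induct) (auto intro: assms)
  then show ?thesis
    by (subst poly_mapping_eq_sum_single) simp
qed

definition pm_ext :: "('a::zero \<Rightarrow> 'k \<Rightarrow> 'c::comm_monoid_add) \<Rightarrow> ('k \<Rightarrow>\<^sub>0 'a) \<Rightarrow> 'c" where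
  "pm_ext b w = (\<Sum>k\<in>Poly_Mapping.keys w. b (Poly_Mapping.lookup w k) k)"

text \<open>Working modulo \<open>J\<close> matters for the base change below, where coefficients
  pass through \<open>tensor_right\<close>.\<close>

definition additive_mod :: "'c::comm_ring_1 set \<Rightarrow> ('a::ab_group_add \<Rightarrow> 'k \<Rightarrow> 'c) \<Rightarrow> bool" where
  "additive_mod J b \<longleftrightarrow> (\<forall>x y k. b (x + y) k - (b x k + b y k) \<in> J)"

lemma additive_mod_0:
  assumes "submodule R J" "additive_mod J b"
  shows "b 0 k \<in> J"
proof -
  have "b (0 + 0) k - (b 0 k + b 0 k) \<in> J" using assms(2) unfolding additive_mod_def by blast
  then show ?thesis using submodule_uminus[OF assms(1), of "- b 0 k"] by simp
qed

lemma pm_ext_superset: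
  assumes J: "submodule R J" and b: "additive_mod J b" and K: "finite K" "Poly_Mapping.keys w \<subseteq> K"
  shows "(\<Sum>k\<in>K. b (Poly_Mapping.lookup w k) k) - pm_ext b w \<in> J"
proof -
  have "(\<Sum>k\<in>K. b (Poly_Mapping.lookup w k) k) - pm_ext b w
      = (\<Sum>k\<in>K - Poly_Mapping.keys w. b (Poly_Mapping.lookup w k) k)"
    using K by (simp add: pm_ext_def sum_diff)
  also have "\<dots> = (\<Sum>k\<in>K - Poly_Mapping.keys w. b 0 k)"
    by (intro sum.cong) (auto simp: in_keys_iff)
  also have "\<dots> \<in> J"
    by (intro submodule_sum[OF J] additive_mod_0[OF J b])
  finally show ?thesis .
qed

lemma pm_ext_add:
  assumes J: "submodule R J" and b: "additive_mod J b"
  shows "pm_ext b (v + w) - (pm_ext b v + pm_ext b w) \<in> J"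
proof -
  define K where "K = Poly_Mapping.keys v \<union> Poly_Mapping.keys w"
  have K: "finite K" "Poly_Mapping.keys v \<subseteq> K" "Poly_Mapping.keys w \<subseteq> K" "Poly_Mapping.keys (v + w) \<subseteq> K"
    using Poly_Mapping.keys_add[of v w] by (auto simp: K_def)
  let ?s = "\<lambda>w. \<Sum>k\<in>K. b (Poly_Mapping.lookup w k) k"
  have "?s (v + w) - (?s v + ?s w)
      = (\<Sum>k\<in>K. b (Poly_Mapping.lookup (v + w) k) k - (b (Poly_Mapping.lookup v k) k + b (Poly_Mapping.lookup w k) k))"
    by (simp add: sum_subtractf sum.distrib)
  also have "\<dots> \<in> J"
    using b by (intro submodule_sum[OF J]) (simp add: additive_mod_def lookup_add)
  finally have "?s (v + w) - (?s v + ?s w) \<in> J" .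
  have "(?s (v + w) - (?s v + ?s w)) - (?s (v + w) - pm_ext b (v + w))
      + ((?s v - pm_ext b v) + (?s w - pm_ext b w)) \<in> J"
    by (rule pm_ext_superset[OF J b] | fact | rule submodule_add[OF J] submodule_diff[OF J])+
  then show ?thesis by (simp add: algebra_simps)
qed

lemma pm_ext_single:
  assumes J: "submodule R J" and b: "additive_mod J b"
  shows "pm_ext b (Poly_Mapping.single k c) - b c k \<in> J"
  using submodule_sym[OF J pm_ext_superset[OF J b, of "{k}" "Poly_Mapping.single k c"]] by simp

lemma pm_ext_0 [simp]: "pm_ext b 0 = 0"
  by (simp add: pm_ext_def)

lemma pm_ext_diff:
  assumes J: "submodule R J" and b: "additive_mod J b"
  shows "pm_ext b (v - w) - (pm_ext b v - pm_ext b w) \<in> J"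
  using submodule_uminus[OF J pm_ext_add[OF J b, of "v - w" w]] by (simp add: algebra_simps)

lemma pm_ext_single_add:
  assumes J: "submodule R J" and b: "additive_mod J b"
  shows "pm_ext b (Poly_Mapping.single k c + w) - (b c k + pm_ext b w) \<in> J"
  using submodule_add[OF J pm_ext_add[OF J b, of "Poly_Mapping.single k c" w] pm_ext_single[OF J b, of k c]]
  by (simp add: algebra_simps)

text \<open>Multiplication by a single term is absorbed into the rule \<open>b\<close>. Products
  with \<open>1 \<otimes> s\<close> and \<open>s \<otimes> 1\<close> thus become changes in the
  arguments of \<open>b\<close>.\<close>

lemma pm_ext_mult_single:
  fixes b :: "'a::comm_ring_1 \<Rightarrow> 'k::comm_monoid_add \<Rightarrow> 'c::comm_ring_1"
  assumes J: "submodule R J" and b: "additive_mod J b"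
  shows "pm_ext b (w * Poly_Mapping.single m c) - pm_ext (\<lambda>u k. b (u * c) (k + m)) w \<in> J"
proof (induction w rule: poly_mapping_single_induct)
  case 1
  show ?case using submodule_0[OF J] by simp
next
  case (2 k d v)
  let ?b = "\<lambda>u k. b (u * c) (k + m)"
  have b': "additive_mod J ?b"
    using b by (simp add: additive_mod_def distrib_right)
  have h1: "pm_ext b (Poly_Mapping.single (k + m) (d * c) + v * Poly_Mapping.single m c)
      - (b (d * c) (k + m) + pm_ext b (v * Poly_Mapping.single m c)) \<in> J"
    by (rule pm_ext_single_add[OF J b])
  have h2: "pm_ext ?b (Poly_Mapping.single k d + v) - (b (d * c) (k + m) + pm_ext ?b v) \<in> J"
    using pm_ext_single_add[OF J b'] by simp
  from submodule_add[OF J submodule_diff[OF J h1 h2] 2] show ?case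
    by (simp add: algebra_simps mult_single)
qed

text \<open>Each rule adds one generator. \<open>I\<close> is killed in the left factor; balancing
  transfers this to the right factor in \<open>tensor_right_ideal\<close>, where
  \<open>I \<subseteq> R\<close>.\<close>

inductive_set tensor_relations :: "'a::comm_ring_1 set \<Rightarrow> 'a set \<Rightarrow> 'a tensor set" for R I where
  zero: "0 \<in> tensor_relations R I"
| add_rel: "w \<in> tensor_relations R I \<Longrightarrow>
    Poly_Mapping.single (Mul (x + y)) c - Poly_Mapping.single (Mul x) c - Poly_Mapping.single (Mul y) c + w
      \<in> tensor_relations R I"
| balance_rel: "r \<in> R \<Longrightarrow> w \<in> tensor_relations R I \<Longrightarrow>
    Poly_Mapping.single (Mul (r * x)) c - Poly_Mapping.single (Mul x) (r * c) + w \<in> tensor_relations R I"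
| ideal_rel: "i \<in> I \<Longrightarrow> w \<in> tensor_relations R I \<Longrightarrow>
    Poly_Mapping.single (Mul x) i + w \<in> tensor_relations R I"

lemma tensor_relations_mono:
  assumes "w \<in> tensor_relations R I" "R \<subseteq> T"
  shows "w \<in> tensor_relations T I"
  using assms by (induction rule: tensor_relations.induct) (auto intro: tensor_relations.intros)

lemma tensor_relations_add:
  assumes "v \<in> tensor_relations R I" "w \<in> tensor_relations R I"
  shows "v + w \<in> tensor_relations R I"
  using assms by (induction rule: tensor_relations.induct) (auto simp: add.assoc intro: tensor_relations.intros)

lemma tensor_relations_mult_single:
  assumes "w \<in> tensor_relations R I" and I: "submodule UNIV I"
  shows "w * Poly_Mapping.single (Mul z) d \<in> tensor_relations R I"
  using assms(1)
proof (induction rule: tensor_relations.induct)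
  case zero
  show ?case by (simp add: tensor_relations.zero)
next
  case (add_rel w x y c)
  then show ?case
    using tensor_relations.add_rel[OF add_rel(2), of "x * z" "y * z" "c * d"]
    by (simp add: algebra_simps mult_single plus_mul_def)
next
  case (balance_rel r w x c)
  then show ?case
    using tensor_relations.balance_rel[OF balance_rel(1,3), of "x * z" "c * d"]
    by (simp add: algebra_simps mult_single plus_mul_def)
next
  case (ideal_rel i w x)
  then show ?case
    using tensor_relations.ideal_rel[OF submodule_mult_right[OF I UNIV_I ideal_rel(1)] ideal_rel(3), of "x * z" d]
    by (simp add: algebra_simps mult_single plus_mul_def)
qed

text \<open>A generator times a single term is again a generator of its kind, and every tensor is a
  sum of single terms. Differences come from multiplying by \<open>- 1\<close>.\<close>

lemma submodule_tensor_relations: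
  assumes I: "submodule UNIV I"
  shows "submodule UNIV (tensor_relations R I)"
proof -
  have mult: "w * v \<in> tensor_relations R I" if "w \<in> tensor_relations R I" for v w
  proof (induction v rule: poly_mapping_single_induct)
    case 1
    show ?case by (simp add: tensor_relations.zero)
  next
    case (2 k c v)
    then show ?case
      using tensor_relations_mult_single[OF that I, of "unmul k" c]
      by (simp add: distrib_left tensor_relations_add)
  qed
  have "v - w \<in> tensor_relations R I" if "v \<in> tensor_relations R I" "w \<in> tensor_relations R I" for v w
    using tensor_relations_add[OF that(1) mult[OF that(2), of "- 1"]] by simp
  then show ?thesis
    using mult tensor_relations_add tensor_relations.zero unfolding submodule_def
    by (metis mult.commute)
qed

lemma tensor_relations_right_add:
  "tensor_right (x + y) - (tensor_right x + tensor_right y) \<in> tensor_relations R I"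
  using tensor_relations.add_rel[OF tensor_relations.zero, of x y 1 R I]
  by (simp add: tensor_right_def algebra_simps)

lemma tensor_relations_right_left: "r \<in> R \<Longrightarrow> tensor_right r - tensor_left r \<in> tensor_relations R I"
  using tensor_relations.balance_rel[OF _ tensor_relations.zero, of r R 1 1 I]
  by (simp add: tensor_right_def tensor_left_def zero_mul_def)

lemma tensor_relations_left: "i \<in> I \<Longrightarrow> tensor_left i \<in> tensor_relations R I"
  using tensor_relations.ideal_rel[OF _ tensor_relations.zero, of i I 1 R]
  by (simp add: tensor_left_def zero_mul_def)

text \<open>Universal property of the tensor product: a rule that is biadditive, balanced and kills
  \<open>I\<close>, all modulo \<open>J\<close>, descends to the quotient by the relations.\<close>

lemma pm_ext_tensor_relations:
  assumes w: "w \<in> tensor_relations R I" and J: "submodule T J" and b: "additive_mod J b"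
    and add: "\<And>c x y. b c (Mul (x + y)) - (b c (Mul x) + b c (Mul y)) \<in> J"
    and bal: "\<And>r c x. r \<in> R \<Longrightarrow> b c (Mul (r * x)) - b (r * c) (Mul x) \<in> J"
    and ideal: "\<And>i x. i \<in> I \<Longrightarrow> b i (Mul x) \<in> J"
  shows "pm_ext b w \<in> J"
  using w
proof (induction rule: tensor_relations.induct)
  case zero
  show ?case using submodule_0[OF J] by simp
next
  case (add_rel w x y c)
  let ?s = "\<lambda>x. Poly_Mapping.single (Mul x) c"
  \<comment> \<open>The summands telescope to the required value, and each of them lies in
    \<open>J\<close>.\<close>
  have "(pm_ext b (?s (x + y) - ?s x - ?s y + w) - (pm_ext b (?s (x + y) - ?s x - ?s y) + pm_ext b w))
     + (pm_ext b (?s (x + y) - ?s x - ?s y) - (pm_ext b (?s (x + y) - ?s x) - pm_ext b (?s y)))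
     + (pm_ext b (?s (x + y) - ?s x) - (pm_ext b (?s (x + y)) - pm_ext b (?s x)))
     + (pm_ext b (?s (x + y)) - b c (Mul (x + y))) - (pm_ext b (?s x) - b c (Mul x)) - (pm_ext b (?s y) - b c (Mul y))
     + (b c (Mul (x + y)) - (b c (Mul x) + b c (Mul y))) + pm_ext b w \<in> J"
    by (rule pm_ext_add[OF J b] pm_ext_diff[OF J b] pm_ext_single[OF J b] add add_rel.IH
      | rule submodule_add[OF J] submodule_diff[OF J])+
  then show ?case by (simp add: algebra_simps)
next
  case (balance_rel r w x c)
  let ?s = "Poly_Mapping.single (Mul (r * x)) c" and ?t = "Poly_Mapping.single (Mul x) (r * c)"
  have "(pm_ext b (?s - ?t + w) - (pm_ext b (?s - ?t) + pm_ext b w))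
     + (pm_ext b (?s - ?t) - (pm_ext b ?s - pm_ext b ?t))
     + (pm_ext b ?s - b c (Mul (r * x))) - (pm_ext b ?t - b (r * c) (Mul x))
     + (b c (Mul (r * x)) - b (r * c) (Mul x)) + pm_ext b w \<in> J"
    by (rule pm_ext_add[OF J b] pm_ext_diff[OF J b] pm_ext_single[OF J b] bal balance_rel.IH
      | fact | rule submodule_add[OF J] submodule_diff[OF J])+
  then show ?case by (simp add: algebra_simps)
next
  case (ideal_rel i w x)
  have "(pm_ext b (Poly_Mapping.single (Mul x) i + w) - (b i (Mul x) + pm_ext b w)) + (b i (Mul x) + pm_ext b w) \<in> J"
    by (rule pm_ext_single_add[OF J b] ideal | fact | rule submodule_add[OF J])+
  then show ?case by simp
qed

text \<open>Modulo \<open>L\<close> the two embeddings of \<open>S\<close> are ring homomorphisms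
  that agree on \<open>R\<close>; their equaliser is a subring.\<close>

lemma coincidence_subring:
  assumes R: "is_subring R" and L: "submodule UNIV L" "tensor_relations R I \<subseteq> L"
  shows "is_subring {s. tensor_right s - tensor_left s \<in> L}" "R \<subseteq> {s. tensor_right s - tensor_left s \<in> L}"
proof -
  let ?Z = "{s. tensor_right s - tensor_left s \<in> L}"
  show RZ: "R \<subseteq> ?Z" using tensor_relations_right_left L by blast
  have mult: "x * y \<in> ?Z" if "x \<in> ?Z" "y \<in> ?Z" for x y
  proof -
    have "tensor_right x * (tensor_right y - tensor_left y) + tensor_left y * (tensor_right x - tensor_left x) \<in> L"
      using that by (intro submodule_add[OF L(1)] submodule_mult[OF L(1)]) auto
    then show ?thesis by (simp add: tensor_right_mult tensor_left_mult algebra_simps)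
  qed
  have add: "x + y \<in> ?Z" if "x \<in> ?Z" "y \<in> ?Z" for x y
  proof -
    have "(tensor_right (x + y) - (tensor_right x + tensor_right y))
      + ((tensor_right x - tensor_left x) + (tensor_right y - tensor_left y)) \<in> L"
      using that L(2) by (intro submodule_add[OF L(1)] subsetD[OF L(2) tensor_relations_right_add]) auto
    then show ?thesis by (simp add: tensor_left_add algebra_simps)
  qed
  have "- 1 \<in> R" using subring_diff[OF R subring_0[OF R] subring_1[OF R]] by simp
  then have "- 1 \<in> ?Z" using RZ by blast
  then have diff: "x - y \<in> ?Z" if "x \<in> ?Z" "y \<in> ?Z" for x y
    using add[OF that(1) mult[OF _ that(2), of "- 1"]] by simp
  show "is_subring ?Z"
    unfolding is_subring_def
    by (intro conjI ballI add mult diff subsetD[OF RZ subring_0[OF R]] subsetD[OF RZ subring_1[OF R]])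
qed

text \<open>The map \<open>c dx \<mapsto> c \<otimes> x - c x \<otimes> 1\<close> from differentials to the diagonal ideal modulo its square.\<close>
lemma kahler_relations_diagonal:
  assumes v: "v \<in> kahler_relations R" and L: "submodule UNIV L" "tensor_relations R I \<subseteq> L"
    and sq: "\<And>x y. (tensor_right x - tensor_left x) * (tensor_right y - tensor_left y) \<in> L"
  shows "pm_ext (\<lambda>c x. tensor_left c * (tensor_right x - tensor_left x)) v \<in> L"
    (is "pm_ext ?b v \<in> L")
proof -
  have b: "additive_mod L ?b"
    using submodule_0[OF L(1)] by (simp add: additive_mod_def tensor_left_add algebra_simps)
  note rules = submodule_add[OF L(1)] submodule_diff[OF L(1)] pm_ext_add[OF L(1) b]
    pm_ext_diff[OF L(1) b] pm_ext_single[OF L(1) b]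
  show ?thesis using v
  proof (induction rule: kahler_relations.induct)
    case zero
    show ?case using submodule_0[OF L(1)] by simp
  next
    case (add_rel w x y c)
    let ?s = "\<lambda>x. Poly_Mapping.single x c"
    have "tensor_left c * (tensor_right (x + y) - (tensor_right x + tensor_right y)) \<in> L"
      using subsetD[OF L(2) tensor_relations_right_add] by (intro submodule_mult[OF L(1)]) auto
    then have bb: "?b c (x + y) - (?b c x + ?b c y) \<in> L"
      by (simp add: tensor_left_add algebra_simps)
    have "(pm_ext ?b (?s (x + y) - ?s x - ?s y + w) - (pm_ext ?b (?s (x + y) - ?s x - ?s y) + pm_ext ?b w))
     + (pm_ext ?b (?s (x + y) - ?s x - ?s y) - (pm_ext ?b (?s (x + y) - ?s x) - pm_ext ?b (?s y)))
     + (pm_ext ?b (?s (x + y) - ?s x) - (pm_ext ?b (?s (x + y)) - pm_ext ?b (?s x)))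
     + (pm_ext ?b (?s (x + y)) - ?b c (x + y)) - (pm_ext ?b (?s x) - ?b c x) - (pm_ext ?b (?s y) - ?b c y)
     + (?b c (x + y) - (?b c x + ?b c y)) + pm_ext ?b w \<in> L"
      by (rule bb add_rel.IH rules(3-5) | rule rules(1,2))+
    then show ?case by (simp add: algebra_simps)
  next
    case (mult_rel w x y c)
    let ?r = "Poly_Mapping.single (x * y) c" and ?s = "Poly_Mapping.single y (c * x)"
      and ?t = "Poly_Mapping.single x (c * y)"
    \<comment> \<open>This is exactly the defect of the Leibniz rule for \<open>?b\<close>.\<close>
    have "tensor_left c * ((tensor_right x - tensor_left x) * (tensor_right y - tensor_left y)) \<in> L"
      by (rule submodule_mult[OF L(1) UNIV_I sq])
    then have bb: "?b c (x * y) - ?b (c * x) y - ?b (c * y) x \<in> L"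
      by (simp add: tensor_left_mult tensor_right_mult algebra_simps)
    have "(pm_ext ?b (?r - ?s - ?t + w) - (pm_ext ?b (?r - ?s - ?t) + pm_ext ?b w))
     + (pm_ext ?b (?r - ?s - ?t) - (pm_ext ?b (?r - ?s) - pm_ext ?b ?t))
     + (pm_ext ?b (?r - ?s) - (pm_ext ?b ?r - pm_ext ?b ?s))
     + (pm_ext ?b ?r - ?b c (x * y)) - (pm_ext ?b ?s - ?b (c * x) y) - (pm_ext ?b ?t - ?b (c * y) x)
     + (?b c (x * y) - ?b (c * x) y - ?b (c * y) x) + pm_ext ?b w \<in> L"
      by (rule bb mult_rel.IH rules(3-5) | rule rules(1,2))+
    then show ?case by (simp add: algebra_simps)
  next
    case (const_rel r w c)
    have bb: "?b c r \<in> L"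
      using subsetD[OF L(2) tensor_relations_right_left[OF const_rel(1)]]
      by (intro submodule_mult[OF L(1)]) auto
    have "(pm_ext ?b (Poly_Mapping.single r c + w) - (?b c r + pm_ext ?b w)) + (?b c r + pm_ext ?b w) \<in> L"
      by (rule bb const_rel.IH pm_ext_single_add[OF L(1) b] | rule rules(1))+
    then show ?case by simp
  qed
qed

text \<open>Finite type, phrased so that it applies directly to the equaliser of two
  homomorphisms.\<close>

definition fg_algebra :: "'a::comm_ring_1 set \<Rightarrow> bool" where
  "fg_algebra R \<longleftrightarrow> (\<exists>F. finite F \<and> (\<forall>T. is_subring T \<and> R \<subseteq> T \<and> F \<subseteq> T \<longrightarrow> T = UNIV))"

lemma fg_algebra_if_fin_pres:
  assumes "fin_pres_ext R"
  shows "fg_algebra R"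
proof -
  obtain n and s :: "nat \<Rightarrow> 'a" where s: "\<And>t. \<exists>p\<in>polys_over R n. mpoly_eval s p = t"
    using assms unfolding fin_pres_ext_def by blast
  have "t \<in> T" if T: "is_subring T" "R \<subseteq> T" "s ` {..<n} \<subseteq> T" for T t
  proof -
    have prod: "prod f K \<in> T" if "\<And>i. i \<in> K \<Longrightarrow> f i \<in> T" for f and K :: "nat set"
      using that by (induction K rule: infinite_finite_induct) (auto simp: subring_1 subring_mult T)
    obtain p where p: "p \<in> polys_over R n" "mpoly_eval s p = t" using s by blast
    have "mpoly_eval s p \<in> T"
      unfolding mpoly_eval_def
    proof (rule submodule_sum[OF submodule_subring[OF T(1)]], rule subring_mult[OF T(1)])
      fix m assume m: "m \<in> Poly_Mapping.keys p"
      show "Poly_Mapping.lookup p m \<in> T" using p T by (auto simp: polys_over_def)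
      show "(\<Prod>i\<in>Poly_Mapping.keys m. s i ^ Poly_Mapping.lookup m i) \<in> T"
        using p m T by (intro prod subring_power[OF T(1)]) (auto simp: polys_over_def)
    qed
    then show ?thesis using p by simp
  qed
  then show ?thesis
    unfolding fg_algebra_def by (intro exI[of _ "s ` {..<n}"]) auto
qed

text \<open>The coefficient set \<open>A\<close> may be an ideal, so products of ideals modulo
  \<open>N\<close> can be written this way.\<close>

definition gspan :: "'a::comm_ring_1 set \<Rightarrow> ('i \<Rightarrow> 'a) \<Rightarrow> 'i set \<Rightarrow> 'a set \<Rightarrow> 'a set" where
  "gspan A g F N = {(\<Sum>j\<in>F. c j * g j) + n | c n. (\<forall>j\<in>F. c j \<in> A) \<and> n \<in> N}"

lemma gspanI: "(\<And>j. j \<in> F \<Longrightarrow> c j \<in> A) \<Longrightarrow> n \<in> N \<Longrightarrow> x = (\<Sum>j\<in>F. c j * g j) + n \<Longrightarrow> x \<in> gspan A g F N"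
  unfolding gspan_def by blast

lemma gspanE:
  assumes "x \<in> gspan A g F N"
  obtains c n where "\<forall>j\<in>F. c j \<in> A" "n \<in> N" "x = (\<Sum>j\<in>F. c j * g j) + n"
  using assms unfolding gspan_def by blast

lemma submodule_gspan:
  assumes A: "submodule R A" and N: "submodule R N"
  shows "submodule R (gspan A g F N)" "N \<subseteq> gspan A g F N"
proof -
  show NG: "N \<subseteq> gspan A g F N"
    using submodule_0[OF A] by (auto intro: gspanI[where c="\<lambda>_. 0"])
  show "submodule R (gspan A g F N)"
    unfolding submodule_def
  proof (intro conjI ballI)
    show "0 \<in> gspan A g F N" using NG submodule_0[OF N] by blast
  next
    fix x y assume "x \<in> gspan A g F N" "y \<in> gspan A g F N"
    then obtain c n d m where *: "\<forall>j\<in>F. c j \<in> A" "n \<in> N" "x = (\<Sum>j\<in>F. c j * g j) + n"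
      "\<forall>j\<in>F. d j \<in> A" "m \<in> N" "y = (\<Sum>j\<in>F. d j * g j) + m"
      by (elim gspanE)
    show "x + y \<in> gspan A g F N"
      using * A N by (intro gspanI[of F "\<lambda>j. c j + d j" A "n + m"])
        (auto intro: submodule_add simp: algebra_simps sum.distrib)
    show "x - y \<in> gspan A g F N"
      using * A N by (intro gspanI[of F "\<lambda>j. c j - d j" A "n - m"])
        (auto intro: submodule_diff simp: algebra_simps sum_subtractf)
  next
    fix r x assume "r \<in> R" "x \<in> gspan A g F N"
    then obtain c n where *: "\<forall>j\<in>F. c j \<in> A" "n \<in> N" "x = (\<Sum>j\<in>F. c j * g j) + n"
      by (elim gspanE)
    show "r * x \<in> gspan A g F N"
      using * A N \<open>r \<in> R\<close> by (intro gspanI[of F "\<lambda>j. r * c j" A "r * n"])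
        (auto intro: submodule_mult simp: distrib_left sum_distrib_left mult.assoc)
  qed
qed

lemma gspan_generator:
  assumes "submodule R A" "submodule R N" "1 \<in> A" "finite F" "i \<in> F"
  shows "g i \<in> gspan A g F N"
  using assms submodule_0
  by (intro gspanI[of F "\<lambda>j. if j = i then 1 else 0" A 0]) (auto simp: if_distrib[of "\<lambda>x. x * _"] cong: if_cong)

text \<open>\<open>D\<close> represents a separability idempotent: it has product \<open>1\<close> and \<open>(1 \<otimes> s) D = (s \<otimes> 1) D\<close>.\<close>
definition separable_mod :: "'a::comm_ring_1 set \<Rightarrow> 'a set \<Rightarrow> bool" where
  "separable_mod R I \<longleftrightarrow> (\<exists>D. pm_ext (\<lambda>c m. c * unmul m) D - 1 \<in> I
     \<and> (\<forall>s. (tensor_right s - tensor_left s) * D \<in> tensor_relations R I))"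

text \<open>Multiplication \<open>c \<otimes> x \<mapsto> c * x\<close> treats
  \<open>1 \<otimes> s\<close> and \<open>s \<otimes> 1\<close> alike: both multiply the value by
  \<open>s\<close>.\<close>

lemma pm_ext_mult_diagonal:
  assumes I: "submodule UNIV I"
  shows "pm_ext (\<lambda>c m. c * unmul m) (w * (tensor_right s - tensor_left s)) \<in> I"
proof -
  let ?\<mu> = "\<lambda>c m. c * unmul m"
  have add: "additive_mod I ?\<mu>"
    using submodule_0[OF I] by (simp add: additive_mod_def algebra_simps)
  have h1: "pm_ext ?\<mu> (w * tensor_right s) - pm_ext (\<lambda>c m. c * unmul m * s) w \<in> I"
    using pm_ext_mult_single[OF I add, of w "Mul s" 1]
    by (simp add: tensor_right_def plus_mul_def mult.assoc)
  have h2: "pm_ext ?\<mu> (w * tensor_left s) - pm_ext (\<lambda>c m. c * unmul m * s) w \<in> I"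
    using pm_ext_mult_single[OF I add, of w 0 s] by (simp add: tensor_left_def ac_simps)
  have "pm_ext ?\<mu> (w * tensor_right s) - pm_ext ?\<mu> (w * tensor_left s) \<in> I"
    using submodule_diff[OF I h1 h2] by simp
  then show ?thesis
    using submodule_mem_cong[OF I pm_ext_diff[OF I add, of "w * tensor_right s" "w * tensor_left s"]]
    by (simp add: right_diff_distrib)
qed

text \<open>Modulo the relations, the diagonal ideal \<open>K\<close> is finitely generated and, as
  the differentials vanish, equal to its square. Nakayama's lemma gives \<open>u\<close> congruent
  to 1 modulo \<open>K\<close> with \<open>u * K\<close> inside the relations; this \<open>u\<close>
  is the separability element.\<close>

lemma separable_mod_if_unramified:
  assumes R: "is_subring R" and I: "submodule UNIV I" "I \<subseteq> R" and unr: "unramified_ext R" and fg: "fg_algebra R"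
  shows "separable_mod R I"
proof -
  define N where "N = tensor_relations R I"
  have N: "submodule UNIV N" unfolding N_def by (rule submodule_tensor_relations[OF I(1)])
  let ?\<delta> = "\<lambda>s. tensor_right s - tensor_left s"
  obtain F where F: "finite F" "\<And>T. is_subring T \<Longrightarrow> R \<subseteq> T \<Longrightarrow> F \<subseteq> T \<Longrightarrow> T = UNIV"
    using fg unfolding fg_algebra_def by blast
  define K where "K = gspan UNIV ?\<delta> F N"
  have U: "submodule UNIV (UNIV :: 'a tensor set)" by (rule submodule_subring[OF subring_UNIV])
  note K = submodule_gspan[OF U N, of ?\<delta> F, folded K_def]
  \<comment> \<open>\<open>L\<close> stands for \<open>K * K + N\<close>.\<close>
  define L where "L = gspan K ?\<delta> F N"
  note L = submodule_gspan[OF K(1) N, of ?\<delta> F, folded L_def]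
  \<comment> \<open>The equaliser modulo \<open>M\<close> contains \<open>R\<close> and the algebra
    generators \<open>F\<close>, so it is all of \<open>S\<close>.\<close>
  have diag: "?\<delta> s \<in> M" if "submodule UNIV M" "N \<subseteq> M" "\<And>s. s \<in> F \<Longrightarrow> ?\<delta> s \<in> M" for M s
    using F(2)[OF coincidence_subring[OF R that(1), of I]] that by (auto simp: N_def)
  have \<delta>K: "?\<delta> s \<in> K" for s
    by (rule diag[OF K], unfold K_def, rule gspan_generator[OF U N UNIV_I F(1)])
  have sq: "?\<delta> x * ?\<delta> y \<in> L" for x y
  proof -
    obtain c n where *: "n \<in> N" "?\<delta> y = (\<Sum>j\<in>F. c j * ?\<delta> j) + n"
      using \<delta>K[of y] unfolding K_def by (elim gspanE)
    show ?thesis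
      unfolding L_def
    proof (rule gspanI)
      show "?\<delta> x * c j \<in> K" if "j \<in> F" for j
        by (rule submodule_mult_right[OF K(1) UNIV_I \<delta>K])
      show "?\<delta> x * n \<in> N" by (rule submodule_mult[OF N UNIV_I *(1)])
      show "?\<delta> x * ?\<delta> y = (\<Sum>j\<in>F. ?\<delta> x * c j * ?\<delta> j) + ?\<delta> x * n"
        by (subst *(2)) (simp only: distrib_left sum_distrib_left mult.assoc)
    qed
  qed
  \<comment> \<open>The differential \<open>d s\<close> is a Kaehler relation, so its image lies in
    \<open>L\<close>; modulo \<open>L\<close> that image is \<open>?\<delta> s\<close>.\<close>
  have \<delta>L: "?\<delta> s \<in> L" for s
  proof -
    have "additive_mod L (\<lambda>c x. tensor_left c * ?\<delta> x)"
      using submodule_0[OF L(1)] by (simp add: additive_mod_def tensor_left_add algebra_simps)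
    from pm_ext_single[OF L(1) this, of s 1]
    have "pm_ext (\<lambda>c x. tensor_left c * ?\<delta> x) (Poly_Mapping.single s 1) - ?\<delta> s \<in> L"
      by (simp add: tensor_left_1)
    moreover have "pm_ext (\<lambda>c x. tensor_left c * ?\<delta> x) (Poly_Mapping.single s 1) \<in> L"
      using unr L sq by (intro kahler_relations_diagonal[of _ R L I]) (auto simp: unramified_ext_def N_def)
    ultimately show ?thesis
      using submodule_mem_cong[OF L(1)] submodule_sym[OF L(1)] by blast
  qed
  have "\<exists>u. 1 - u \<in> K \<and> (\<forall>i\<in>F. u * ?\<delta> i \<in> N)"
  proof (rule nakayama[OF subring_UNIV K(1) _ N F(1)])
    fix i assume "i \<in> F"
    obtain c n where *: "\<forall>j\<in>F. c j \<in> K" "n \<in> N" "?\<delta> i = (\<Sum>j\<in>F. c j * ?\<delta> j) + n"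
      using \<delta>L[of i] unfolding L_def by (elim gspanE)
    have "1 * ?\<delta> i - (\<Sum>j\<in>F. c j * ?\<delta> j) \<in> N"
      using *(2) by (subst *(3)) simp
    then show "\<exists>u c. 1 - u \<in> K \<and> (\<forall>j\<in>F. c j \<in> K) \<and> u * ?\<delta> i - (\<Sum>j\<in>F. c j * ?\<delta> j) \<in> N"
      using *(1) submodule_0[OF K(1)] by (intro exI[of _ 1] exI[of _ c]) auto
  qed auto
  then obtain u where u: "1 - u \<in> K" "\<And>i. i \<in> F \<Longrightarrow> u * ?\<delta> i \<in> N" by blast
  have "?\<delta> s * u \<in> N" for s
  proof -
    have "submodule UNIV {w. u * w \<in> N}"
      using N by (auto simp: submodule_def distrib_left right_diff_distrib mult.left_commute)
    from diag[OF this] have "u * ?\<delta> s \<in> N"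
      using u(2) submodule_mult[OF N] by blast
    then show ?thesis by (simp only: mult.commute)
  qed
  \<comment> \<open>The multiplication map sends \<open>K\<close>, hence \<open>1 - u\<close>, into
    \<open>I\<close>.\<close>
  moreover have "pm_ext (\<lambda>c m. c * unmul m) u - 1 \<in> I"
  proof -
    let ?\<mu> = "\<lambda>c m. c * unmul m"
    have add: "additive_mod I ?\<mu>"
      using submodule_0[OF I(1)] by (simp add: additive_mod_def algebra_simps)
    obtain c n where *: "n \<in> N" "1 - u = (\<Sum>j\<in>F. c j * ?\<delta> j) + n"
      using u(1) unfolding K_def by (elim gspanE)
    have "pm_ext ?\<mu> (\<Sum>j\<in>F'. c j * ?\<delta> j) \<in> I" if "finite F'" for F'
      using that
    proof (induction F' rule: finite_induct)
      case empty
      show ?case using submodule_0[OF I(1)] by simp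
    next
      case (insert j F')
      have "pm_ext ?\<mu> (c j * ?\<delta> j + (\<Sum>j\<in>F'. c j * ?\<delta> j)) \<in> I"
        by (rule submodule_mem_cong[OF I(1) pm_ext_add[OF I(1) add]], rule submodule_add[OF I(1)],
            rule pm_ext_mult_diagonal[OF I(1)], rule insert.IH)
      then show ?case
        by (simp only: sum.insert[OF insert.hyps])
    qed
    then have "pm_ext ?\<mu> (\<Sum>j\<in>F. c j * ?\<delta> j) \<in> I" using F(1) by blast
    moreover have "pm_ext ?\<mu> n \<in> I"
      using *(1) unfolding N_def
      by (rule pm_ext_tensor_relations[OF _ I(1) add])
         (auto simp: algebra_simps submodule_0[OF I(1)] submodule_mult[OF I(1)] submodule_mult_right[OF I(1)])
    ultimately have "pm_ext ?\<mu> (1 - u) \<in> I"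
      unfolding *(2) using submodule_mem_cong[OF I(1) pm_ext_add[OF I(1) add]] submodule_add[OF I(1)] by blast
    then have h1: "pm_ext ?\<mu> 1 - pm_ext ?\<mu> u \<in> I"
      using submodule_mem_cong[OF I(1) submodule_sym[OF I(1) pm_ext_diff[OF I(1) add]]] by blast
    have h2: "pm_ext ?\<mu> 1 - 1 \<in> I"
      using pm_ext_single[OF I(1) add, of 0 1] by (simp add: zero_mul_def flip: single_one)
    show ?thesis
      using submodule_diff[OF I(1) h2 h1] by simp
  qed
  ultimately show ?thesis
    unfolding separable_mod_def N_def by blast
qed

section \<open>Averaging over a separability element\<close>

text \<open>Elements of \<open>I\<close> are scalars in \<open>R\<close>, so \<open>i\<close> can be
  pulled out of \<open>\<phi> (i * 1)\<close>.\<close>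

lemma linear_mod_ideal:
  assumes I: "submodule UNIV I" "I \<subseteq> R" and \<phi>: "linear_mod R I \<phi>" and i: "i \<in> I"
  shows "\<phi> i \<in> I"
proof -
  have "\<phi> (i * 1) - i * \<phi> 1 \<in> I"
    using \<phi> i I(2) unfolding linear_mod_def by blast
  then show ?thesis
    using submodule_mem_cong[OF I(1) _ submodule_mult_right[OF I(1) UNIV_I i]] by simp
qed

lemma linear_mod_sum:
  assumes I: "submodule UNIV I" "I \<subseteq> R" and \<phi>: "linear_mod R I \<phi>"
    and F: "finite F" "\<forall>x\<in>F. c x \<in> R"
  shows "\<phi> (\<Sum>x\<in>F. c x * h x) - (\<Sum>x\<in>F. c x * \<phi> (h x)) \<in> I"
  using F
proof (induction F rule: finite_induct)
  case empty
  show ?case using linear_mod_ideal[OF I \<phi> submodule_0[OF I(1)]] by simp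
next
  case (insert x F)
  have h1: "\<phi> (c x * h x + (\<Sum>x\<in>F. c x * h x)) - (\<phi> (c x * h x) + \<phi> (\<Sum>x\<in>F. c x * h x)) \<in> I"
    and h2: "\<phi> (c x * h x) - c x * \<phi> (h x) \<in> I"
    using \<phi> insert.prems unfolding linear_mod_def by auto
  have h3: "\<phi> (\<Sum>x\<in>F. c x * h x) - (\<Sum>x\<in>F. c x * \<phi> (h x)) \<in> I"
    using insert by blast
  show ?case
    using submodule_add[OF I(1) h1 submodule_add[OF I(1) h2 h3]] insert.hyps by (simp add: algebra_simps)
qed

lemma pm_ext_linear_tensor_relations:
  assumes I: "submodule UNIV I" and \<phi>: "linear_mod R I \<phi>" and w: "w \<in> tensor_relations R I"
  shows "pm_ext (\<lambda>c m. c * \<phi> (unmul m * t)) w \<in> I"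
  using w
proof (rule pm_ext_tensor_relations[OF _ I])
  show "additive_mod I (\<lambda>c m. c * \<phi> (unmul m * t))"
    using submodule_0[OF I] by (simp add: additive_mod_def algebra_simps)
  show "c * \<phi> (unmul (Mul (x + y)) * t) - (c * \<phi> (unmul (Mul x) * t) + c * \<phi> (unmul (Mul y) * t)) \<in> I" for c x y
  proof -
    have "\<phi> (x * t + y * t) - (\<phi> (x * t) + \<phi> (y * t)) \<in> I"
      using \<phi> unfolding linear_mod_def by blast
    from submodule_mult[OF I UNIV_I this, of c] show ?thesis by (simp add: algebra_simps)
  qed
  show "c * \<phi> (unmul (Mul (r * x)) * t) - r * c * \<phi> (unmul (Mul x) * t) \<in> I" if "r \<in> R" for r c x
  proof -
    have "\<phi> (r * (x * t)) - r * \<phi> (x * t) \<in> I"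
      using \<phi> that unfolding linear_mod_def by blast
    from submodule_mult[OF I UNIV_I this, of c] show ?thesis by (simp add: algebra_simps)
  qed
  show "i * \<phi> (unmul (Mul x) * t) \<in> I" if "i \<in> I" for i x
    by (rule submodule_mult_right[OF I UNIV_I that])
qed

text \<open>Let \<open>\<psi> t\<close> be the average of \<open>\<phi>\<close> over
  \<open>D\<close>. Multiplying \<open>D\<close> by \<open>1 \<otimes> s\<close> replaces
  \<open>\<psi> t\<close> by \<open>\<psi> (s * t)\<close>, multiplying it by
  \<open>s \<otimes> 1\<close> gives \<open>s * \<psi> t\<close>, and the two products agree modulo
  the relations.\<close>

lemma average_linear:
  assumes I: "submodule UNIV I" and \<phi>: "linear_mod R I \<phi>"
    and D: "(tensor_right s - tensor_left s) * D \<in> tensor_relations R I"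
  shows "pm_ext (\<lambda>c m. c * \<phi> (unmul m * (s * t))) D - s * pm_ext (\<lambda>c m. c * \<phi> (unmul m * t)) D \<in> I"
proof -
  let ?b = "\<lambda>c m. c * \<phi> (unmul m * t)"
  have b: "additive_mod I ?b"
    using submodule_0[OF I] by (simp add: additive_mod_def algebra_simps)
  have h1: "pm_ext ?b (D * tensor_right s) - pm_ext (\<lambda>c m. c * \<phi> (unmul m * (s * t))) D \<in> I"
    using pm_ext_mult_single[OF I b, of D "Mul s" 1]
    by (simp add: tensor_right_def plus_mul_def mult.assoc)
  have "pm_ext ?b (D * tensor_left s) - pm_ext (\<lambda>c m. c * s * \<phi> (unmul m * t)) D \<in> I"
    using pm_ext_mult_single[OF I b, of D 0 s] by (simp add: tensor_left_def)
  moreover have "pm_ext (\<lambda>c m. c * s * \<phi> (unmul m * t)) D = s * pm_ext ?b D"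
    by (simp add: pm_ext_def sum_distrib_left ac_simps)
  ultimately have h2: "pm_ext ?b (D * tensor_left s) - s * pm_ext ?b D \<in> I" by simp
  have h3: "pm_ext ?b (D * tensor_right s - D * tensor_left s)
      - (pm_ext ?b (D * tensor_right s) - pm_ext ?b (D * tensor_left s)) \<in> I"
    by (rule pm_ext_diff[OF I b])
  have h4: "pm_ext ?b (D * tensor_right s - D * tensor_left s) \<in> I"
    using pm_ext_linear_tensor_relations[OF I \<phi> D, of t] by (simp add: algebra_simps)
  show ?thesis
    using submodule_diff[OF I h2 submodule_add[OF I h1 submodule_diff[OF I h3 h4]]]
    by (simp add: algebra_simps)
qed

text \<open>Asking \<open>\<phi>\<close> to fix just the elements \<open>unmul m * t\<close> allows
  projections onto spans that are not ideals, as in \<open>finite_ext_if_separable\<close>.\<close>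

lemma average_id:
  assumes I: "submodule UNIV I" and D: "pm_ext (\<lambda>c m. c * unmul m) D - 1 \<in> I"
    and \<phi>: "\<And>m. m \<in> Poly_Mapping.keys D \<Longrightarrow> \<phi> (unmul m * t) - unmul m * t \<in> I"
  shows "pm_ext (\<lambda>c m. c * \<phi> (unmul m * t)) D - t \<in> I"
proof -
  have "pm_ext (\<lambda>c m. c * \<phi> (unmul m * t)) D - pm_ext (\<lambda>c m. c * unmul m) D * t
      = (\<Sum>m\<in>Poly_Mapping.keys D. Poly_Mapping.lookup D m * (\<phi> (unmul m * t) - unmul m * t))"
    by (simp add: pm_ext_def sum_distrib_left sum_subtractf algebra_simps)
  also have "\<dots> \<in> I"
    by (rule submodule_sum[OF I], rule submodule_mult[OF I UNIV_I \<phi>])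
  finally have h1: "pm_ext (\<lambda>c m. c * \<phi> (unmul m * t)) D - pm_ext (\<lambda>c m. c * unmul m) D * t \<in> I" .
  show ?thesis
    using submodule_add[OF I h1 submodule_mult_right[OF I UNIV_I D, of t]] by (simp add: algebra_simps)
qed

text \<open>Modulo \<open>I\<close>, the averaged projection \<open>\<psi>\<close> is
  \<open>S\<close>-linear and fixes \<open>P\<close>, so it is multiplication by
  \<open>\<psi> 1\<close>, an element of \<open>P\<close>.\<close>

lemma semisimple_mod_if_separable:
  assumes R: "is_subring R" and I: "submodule UNIV I" "I \<subseteq> R" and ss: "semisimple_mod R I"
    and sep: "separable_mod R I"
  shows "semisimple_mod UNIV I"
  unfolding semisimple_mod_def
proof (intro allI impI)
  fix P assume "submodule UNIV P \<and> P \<subseteq> UNIV \<and> I \<subseteq> P"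
  then have P: "submodule UNIV P" "I \<subseteq> P" by auto
  obtain D where D: "pm_ext (\<lambda>c m. c * unmul m) D - 1 \<in> I"
    "\<And>s. (tensor_right s - tensor_left s) * D \<in> tensor_relations R I"
    using sep unfolding separable_mod_def by blast
  obtain \<phi> where \<phi>: "linear_mod R I \<phi>" "\<And>x. \<phi> x \<in> P" "\<And>x. x \<in> P \<Longrightarrow> \<phi> x - x \<in> I"
    using linear_projection_exists[OF R I ss submodule_antimono[OF P(1)] P(2)] by blast
  define \<psi> where "\<psi> t = pm_ext (\<lambda>c m. c * \<phi> (unmul m * t)) D" for t
  have "\<psi> 1 \<in> P"
    unfolding \<psi>_def pm_ext_def by (rule submodule_sum[OF P(1)], rule submodule_mult[OF P(1) UNIV_I \<phi>(2)])
  moreover have "p - p * \<psi> 1 \<in> I" if "p \<in> P" for p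
  proof -
    have "\<psi> p - p \<in> I"
      unfolding \<psi>_def using that by (intro average_id[OF I(1) D(1)] \<phi>(3) submodule_mult[OF P(1)]) auto
    moreover have "\<psi> p - p * \<psi> 1 \<in> I"
      using average_linear[OF I(1) \<phi>(1) D(2), of p 1] by (simp add: \<psi>_def)
    ultimately show ?thesis
      using submodule_trans[OF I(1) submodule_sym[OF I(1)]] by blast
  qed
  ultimately show "\<exists>e\<in>P. \<forall>p\<in>P. p - p * e \<in> I" by blast
qed

section \<open>Finiteness of a separable extension of a semisimple base\<close>

lemma finite_ext_iff_gspan: "finite_ext R \<longleftrightarrow> (\<exists>F. finite F \<and> gspan R (\<lambda>x. x) F {0} = UNIV)"
proof -
  have "s \<in> gspan R (\<lambda>x. x) F {0} \<longleftrightarrow> (\<exists>c. (\<forall>x\<in>F. c x \<in> R) \<and> s = (\<Sum>x\<in>F. c x * x))" for s F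
    by (auto simp: gspan_def)
  then show ?thesis unfolding finite_ext_def set_eq_iff by simp
qed

lemma finite_ext_if_gspan:
  assumes R: "is_subring R" and K: "finite K" and gen: "\<And>t. t \<in> gspan R g K R"
  shows "finite_ext R"
proof -
  have zero: "submodule R {0}" by (simp add: submodule_def)
  define F where "F = insert 1 (g ` K)"
  define U where "U = gspan R (\<lambda>x. x) F {0}"
  have F: "finite F" using K by (simp add: F_def)
  note U = submodule_gspan(1)[OF submodule_subring[OF R] zero, of "\<lambda>x. x" F, folded U_def]
  have FU: "x \<in> U" if "x \<in> F" for x
    unfolding U_def using gspan_generator[OF submodule_subring[OF R] zero subring_1[OF R] F that, of "\<lambda>x. x"] .
  have "t \<in> U" for t
  proof -
    obtain c n where *: "\<forall>j\<in>K. c j \<in> R" "n \<in> R" "t = (\<Sum>j\<in>K. c j * g j) + n"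
      using gen[of t] by (elim gspanE)
    have "(\<Sum>j\<in>K. c j * g j) \<in> U"
      by (rule submodule_sum[OF U], rule submodule_mult[OF U]) (use * in \<open>auto intro: FU simp: F_def\<close>)
    moreover have "n \<in> U" using submodule_mult[OF U *(2) FU[of 1]] by (simp add: F_def)
    ultimately show ?thesis using submodule_add[OF U] *(3) by simp
  qed
  then show ?thesis unfolding finite_ext_iff_gspan using F U_def by blast
qed

text \<open>Let \<open>\<phi>\<close> project onto the span \<open>W\<close> of the right factors of
  \<open>D\<close>. Its average \<open>\<psi>\<close> is \<open>S\<close>-linear with
  \<open>\<psi> 1\<close> congruent to 1, so it is the identity modulo \<open>I\<close>; yet its
  values are, modulo \<open>I\<close>, \<open>R\<close>-combinations of the finitely many products
  of a left and a right factor.\<close>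

lemma finite_ext_if_separable:
  assumes R: "is_subring R" and I: "submodule UNIV I" "I \<subseteq> R" and ss: "semisimple_mod R I"
    and sep: "separable_mod R I"
  shows "finite_ext R"
proof -
  obtain D where D: "pm_ext (\<lambda>c m. c * unmul m) D - 1 \<in> I"
    "\<And>s. (tensor_right s - tensor_left s) * D \<in> tensor_relations R I"
    using sep unfolding separable_mod_def by blast
  let ?K = "Poly_Mapping.keys D"
  note RR = submodule_subring[OF R] and IR = submodule_antimono[OF I(1) subset_UNIV, of R]
  define W where "W = gspan R unmul ?K I"
  note W = submodule_gspan[OF RR IR, of unmul ?K, folded W_def]
  obtain \<phi> where \<phi>: "linear_mod R I \<phi>" "\<And>x. \<phi> x \<in> W" "\<And>x. x \<in> W \<Longrightarrow> \<phi> x - x \<in> I"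
    using linear_projection_exists[OF R I ss W] by blast
  define \<psi> where "\<psi> t = pm_ext (\<lambda>c m. c * \<phi> (unmul m * t)) D" for t
  define h where "h = (\<lambda>(m, k). Poly_Mapping.lookup D m * unmul k)"
  define G where "G = gspan R h (?K \<times> ?K) I"
  note G = submodule_gspan[OF RR IR, of h "?K \<times> ?K", folded G_def]
  have hG: "h mk \<in> G" if "mk \<in> ?K \<times> ?K" for mk
    unfolding G_def using that by (intro gspan_generator[OF RR IR subring_1[OF R]]) auto
  have "\<psi> 1 - 1 \<in> I"
    unfolding \<psi>_def
  proof (rule average_id[OF I(1) D(1)])
    fix m assume "m \<in> ?K"
    then have "unmul m \<in> W"
      unfolding W_def by (intro gspan_generator[OF RR IR subring_1[OF R]]) auto
    then show "\<phi> (unmul m * 1) - unmul m * 1 \<in> I" using \<phi>(3) by simp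
  qed
  have "t \<in> G" for t
  proof -
    have "\<psi> t \<in> G"
      unfolding \<psi>_def pm_ext_def
    proof (rule submodule_sum[OF G(1)])
      fix m assume m: "m \<in> ?K"
      obtain c n where *: "\<forall>j\<in>?K. c j \<in> R" "n \<in> I" "\<phi> (unmul m * t) = (\<Sum>j\<in>?K. c j * unmul j) + n"
        using \<phi>(2)[of "unmul m * t"] unfolding W_def by (elim gspanE)
      have "(\<Sum>k\<in>?K. c k * h (m, k)) + Poly_Mapping.lookup D m * n \<in> G"
      proof (rule submodule_add[OF G(1)])
        show "(\<Sum>k\<in>?K. c k * h (m, k)) \<in> G"
          by (rule submodule_sum[OF G(1)], rule submodule_mult[OF G(1)]) (use * m in \<open>auto intro: hG\<close>)
        show "Poly_Mapping.lookup D m * n \<in> G"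
          using submodule_mult[OF I(1) UNIV_I *(2)] G(2) by blast
      qed
      then show "Poly_Mapping.lookup D m * \<phi> (unmul m * t) \<in> G"
        unfolding *(3) by (simp add: h_def distrib_left sum_distrib_left mult.left_commute)
    qed
    moreover have "\<psi> t - t * \<psi> 1 \<in> G"
      using average_linear[OF I(1) \<phi>(1) D(2), of t 1] G(2) by (auto simp: \<psi>_def)
    moreover have "t * (\<psi> 1 - 1) \<in> G"
      using submodule_mult[OF I(1) UNIV_I \<open>\<psi> 1 - 1 \<in> I\<close>] G(2) by blast
    ultimately have "\<psi> t - (\<psi> t - t * \<psi> 1) - t * (\<psi> 1 - 1) \<in> G"
      by (metis submodule_diff[OF G(1)])
    then show ?thesis by (simp add: algebra_simps)
  qed
  moreover have "G \<subseteq> gspan R h (?K \<times> ?K) R"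
    unfolding G_def gspan_def using I(2) by blast
  ultimately show ?thesis
    by (intro finite_ext_if_gspan[OF R, of "?K \<times> ?K" h]) auto
qed

text \<open>The idempotent generating the ideal of \<open>a\<close> has the form
  \<open>i + r * a\<close>, and \<open>r\<close> is then a quasi-inverse.\<close>

lemma regular_mod_if_semisimple:
  assumes R: "is_subring R" and I: "submodule UNIV I" "I \<subseteq> R" and ss: "semisimple_mod R I"
  shows "regular_mod R I"
  unfolding regular_mod_def
proof
  fix a assume a: "a \<in> R"
  define P where "P = {i + r * a | i r. i \<in> I \<and> r \<in> R}"
  have IR: "submodule R I" by (rule submodule_antimono[OF I(1) subset_UNIV])
  have P: "submodule R P" unfolding P_def by (rule submodule_adjoin[OF R IR])
  have "P \<subseteq> R"
    using I(2) a R by (auto simp: P_def intro!: subring_add subring_mult)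
  moreover have "I \<subseteq> P"
  proof
    fix i assume "i \<in> I"
    then show "i \<in> P"
      unfolding P_def using subring_0[OF R] by (intro CollectI exI[of _ i] exI[of _ 0]) simp
  qed
  moreover have "a \<in> P"
    unfolding P_def using subring_1[OF R] submodule_0[OF I(1)]
    by (intro CollectI exI[of _ 0] exI[of _ 1]) simp
  ultimately obtain e where e: "e \<in> P" "a - a * e \<in> I"
    using ss[unfolded semisimple_mod_def, rule_format, of P] P by auto
  then obtain i r where *: "e = i + r * a" "i \<in> I" "r \<in> R" by (auto simp: P_def)
  have "a - a * e + a * i \<in> I"
    by (intro submodule_add[OF I(1)] submodule_mult[OF I(1)] e *) simp
  then have "a - a * a * r \<in> I" by (simp add: * algebra_simps)
  then show "\<exists>b\<in>R. a - a * a * b \<in> I" using * by blast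
qed

text \<open>A projection onto \<open>U\<close> carries finitely many generators of \<open>S\<close>
  to generators of \<open>U\<close> modulo \<open>I\<close>.\<close>

lemma finite_gen_submodule:
  fixes R :: "'a::comm_ring_1 set"
  assumes R: "is_subring R" and I: "submodule UNIV I" "I \<subseteq> R" and ss: "semisimple_mod R I"
    and fin: "finite_ext R" and U: "submodule R U" "I \<subseteq> U"
  obtains F :: "'a set" and g where "finite F" "range g \<subseteq> U" "U \<subseteq> gspan R g F I"
proof -
  obtain \<phi> where \<phi>: "linear_mod R I \<phi>" "\<And>x. \<phi> x \<in> U" "\<And>x. x \<in> U \<Longrightarrow> \<phi> x - x \<in> I"
    using linear_projection_exists[OF R I ss U] by blast
  obtain F where F: "finite F" "gspan R (\<lambda>x. x) F {0} = UNIV"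
    using fin unfolding finite_ext_iff_gspan by blast
  have "u \<in> gspan R \<phi> F I" if "u \<in> U" for u
  proof -
    have "u \<in> gspan R (\<lambda>x. x) F {0}" using F by simp
    then obtain c where c: "\<forall>j\<in>F. c j \<in> R" "u = (\<Sum>j\<in>F. c j * j)"
      by (elim gspanE) auto
    have "\<phi> u - (\<Sum>j\<in>F. c j * \<phi> j) \<in> I"
      unfolding c(2) by (rule linear_mod_sum[OF I \<phi>(1) F(1) c(1)])
    from submodule_diff[OF I(1) this \<phi>(3)[OF that]]
    have "u - (\<Sum>j\<in>F. c j * \<phi> j) \<in> I" by simp
    then show ?thesis using c(1) by (intro gspanI[of F c R "u - (\<Sum>j\<in>F. c j * \<phi> j)"]) auto
  qed
  then show ?thesis using F(1) \<phi>(2) by (intro that[of F \<phi>]) auto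
qed

text \<open>In a von Neumann regular ring every finitely generated ideal is generated by an
  idempotent, so finite generation of all ideals suffices.\<close>

lemma semisimple_mod_if_regular:
  assumes T: "is_subring T" and I: "submodule UNIV I" and reg: "regular_mod T I"
    and gen: "\<And>P. submodule T P \<Longrightarrow> P \<subseteq> T \<Longrightarrow> I \<subseteq> P \<Longrightarrow>
      \<exists>(F :: 'i set) g. finite F \<and> (\<forall>x\<in>F. g x \<in> P) \<and> P \<subseteq> gspan T g F I"
  shows "semisimple_mod T I"
  unfolding semisimple_mod_def
proof (intro allI impI)
  fix P assume "submodule T P \<and> P \<subseteq> T \<and> I \<subseteq> P"
  then have P: "submodule T P" "P \<subseteq> T" "I \<subseteq> P" by auto
  obtain F :: "'i set" and g where F: "finite F" "\<forall>x\<in>F. g x \<in> P" "P \<subseteq> gspan T g F I"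
    using gen[OF P] by blast
  have "\<exists>e\<in>P. \<forall>x\<in>F. g x - g x * e \<in> I" using F(1,2)
  proof (induction F rule: finite_induct)
    case empty
    show ?case using submodule_0[OF P(1)] by blast
  next
    case (insert y F)
    then obtain e where e: "e \<in> P" "\<And>x. x \<in> F \<Longrightarrow> g x - g x * e \<in> I" by auto
    \<comment> \<open>\<open>p\<close> is the part of \<open>g y\<close> missed by \<open>e\<close>,
      and \<open>f\<close> below fixes \<open>p\<close> modulo \<open>I\<close>. The union
      \<open>e'\<close> satisfies \<open>1 - e' = (1 - e) * (1 - f)\<close>.\<close>
    define p where "p = g y * (1 - e)"
    have "1 - e \<in> T" using e P T by (auto intro: subring_diff subring_1)
    then have pP: "p \<in> P" using insert.prems submodule_mult_right[OF P(1)] by (auto simp: p_def)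
    then obtain u where u: "u \<in> T" "p - p * p * u \<in> I"
      using reg P(2) unfolding regular_mod_def by blast
    define f where "f = p * u"
    have fP: "f \<in> P" unfolding f_def by (rule submodule_mult_right[OF P(1) u(1) pP])
    define e' where "e' = e + f - e * f"
    have "e' \<in> P"
      unfolding e'_def using e fP P by (intro submodule_diff[OF P(1)] submodule_add[OF P(1)] submodule_mult[OF P(1)]) auto
    moreover have "g x - g x * e' \<in> I" if "x \<in> F" for x
      using submodule_mult_right[OF I UNIV_I e(2)[OF that], of "1 - f"] by (simp add: e'_def algebra_simps)
    moreover have "g y - g y * e' \<in> I"
      using u(2) by (simp add: e'_def f_def p_def algebra_simps)
    ultimately show ?case by auto
  qed
  then obtain e where e: "e \<in> P" "\<And>x. x \<in> F \<Longrightarrow> g x - g x * e \<in> I" by auto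
  have "p - p * e \<in> I" if p: "p \<in> P" for p
  proof -
    obtain c n where *: "n \<in> I" "p = (\<Sum>j\<in>F. c j * g j) + n"
      using F(3) p by (blast elim: gspanE)
    have "p - p * e = (\<Sum>j\<in>F. c j * (g j - g j * e)) + n * (1 - e)"
      unfolding *(2) by (simp add: algebra_simps sum_subtractf sum_distrib_left)
    also have "\<dots> \<in> I"
    proof (rule submodule_add[OF I])
      show "(\<Sum>j\<in>F. c j * (g j - g j * e)) \<in> I"
        by (rule submodule_sum[OF I], rule submodule_mult[OF I UNIV_I e(2)])
      show "n * (1 - e) \<in> I" by (rule submodule_mult_right[OF I UNIV_I *(1)])
    qed
    finally show ?thesis .
  qed
  then show "\<exists>e\<in>P. \<forall>p\<in>P. p - p * e \<in> I" using e(1) by blast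
qed

section \<open>Intermediate rings and finiteness of the set of ideals\<close>

lemma regular_mod_power:
  assumes I: "submodule UNIV I" and s: "t - t * t * s \<in> I"
  shows "t ^ Suc k * s ^ k - t \<in> I"
proof (induction k)
  case 0
  show ?case using submodule_0[OF I] by simp
next
  case (Suc k)
  have "(t ^ Suc k * s ^ k - t) - (t ^ k * s ^ k) * (t - t * t * s) \<in> I"
    by (intro submodule_diff[OF I] submodule_mult[OF I] Suc s) simp
  then show ?case by (simp add: algebra_simps)
qed

lemma submodule_UN:
  assumes V: "\<And>n::nat. submodule R (V n)" and mono: "\<And>n m. n \<le> m \<Longrightarrow> V n \<subseteq> V m"
  shows "submodule R (\<Union>n. V n)"
  unfolding submodule_def
proof (intro conjI ballI)
  show "0 \<in> (\<Union>n. V n)" using submodule_0[OF V] by blast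
next
  fix x y assume "x \<in> (\<Union>n. V n)" "y \<in> (\<Union>n. V n)"
  then obtain n m where "x \<in> V n" "y \<in> V m" by blast
  then have "x \<in> V (max n m)" "y \<in> V (max n m)"
    using mono[of n "max n m"] mono[of m "max n m"] by auto
  from submodule_add[OF V this] submodule_diff[OF V this]
  show "x + y \<in> (\<Union>n. V n)" "x - y \<in> (\<Union>n. V n)" by auto
next
  fix r x assume "r \<in> R" "x \<in> (\<Union>n. V n)"
  then show "r * x \<in> (\<Union>n. V n)" using submodule_mult[OF V] by auto
qed

lemma regular_mod_intermediate:
  fixes R :: "'a::comm_ring_1 set"
  assumes R: "is_subring R" and I: "submodule UNIV I" "I \<subseteq> R" and ss: "semisimple_mod R I"
    and fin: "finite_ext R" and reg: "regular_mod UNIV I" and T: "is_subring T" "R \<subseteq> T"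
  shows "regular_mod T I"
  unfolding regular_mod_def
proof
  fix t assume t: "t \<in> T"
  obtain s where s: "t - t * t * s \<in> I" using reg unfolding regular_mod_def by blast
  note RR = submodule_subring[OF R] and IR = submodule_antimono[OF I(1) subset_UNIV, of R]
  \<comment> \<open>The modules spanned by \<open>1, s, \<dots>, s\<^sup>n\<close> stabilise, so \<open>s\<close> is integral over \<open>R\<close> modulo \<open>I\<close>; multiplying
    the integral equation by a power of \<open>t\<close> expresses \<open>t\<close> as \<open>t\<^sup>2\<close> times a polynomial in \<open>t\<close>.\<close>
  define V where "V n = gspan R (\<lambda>i. s ^ i) {..<n} I" for n :: nat
  have V: "submodule R (V n)" "I \<subseteq> V n" for n
    unfolding V_def by (rule submodule_gspan[OF RR IR])+
  have V_power: "s ^ i \<in> V n" if "i < n" for i n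
    unfolding V_def using that by (intro gspan_generator[OF RR IR subring_1[OF R]]) auto
  have V_mono: "V n \<subseteq> V m" if "n \<le> m" for n m
  proof
    fix x assume "x \<in> V n"
    then obtain c i where *: "\<forall>j\<in>{..<n}. c j \<in> R" "i \<in> I" "x = (\<Sum>j<n. c j * s ^ j) + i"
      unfolding V_def by (elim gspanE)
    have "(\<Sum>j<n. c j * s ^ j) \<in> V m"
      by (rule submodule_sum[OF V(1)], rule submodule_mult[OF V(1)]) (use * that in \<open>auto intro: V_power\<close>)
    then show "x \<in> V m" using * V submodule_add by blast
  qed
  define U where "U = (\<Union>n. V n)"
  have U: "submodule R U"
    unfolding U_def by (rule submodule_UN[OF V(1) V_mono])
  have IU: "I \<subseteq> U" using V(2) by (auto simp: U_def)
  obtain F :: "'a set" and g where F: "finite F" "range g \<subseteq> U" "U \<subseteq> gspan R g F I"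
    by (rule finite_gen_submodule[OF R I ss fin U IU])
  have "\<exists>n. g x \<in> V n" for x using F(2) by (auto simp: U_def)
  then obtain \<nu> where \<nu>: "\<And>x. g x \<in> V (\<nu> x)" by metis
  \<comment> \<open>All of the finitely many generators of \<open>U\<close> already lie in
    \<open>V N\<close>.\<close>
  define N where "N = Max (insert 0 (\<nu> ` F))"
  have gN: "g x \<in> V N" if "x \<in> F" for x
    using \<nu>[of x] V_mono[of "\<nu> x" N] that F(1) by (auto simp: N_def)
  have "U \<subseteq> V N"
  proof
    fix x assume "x \<in> U"
    then obtain c i where *: "\<forall>j\<in>F. c j \<in> R" "i \<in> I" "x = (\<Sum>j\<in>F. c j * g j) + i"
      using F(3) by (blast elim: gspanE)
    have "(\<Sum>j\<in>F. c j * g j) \<in> V N"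
      by (rule submodule_sum[OF V(1)], rule submodule_mult[OF V(1)]) (use * in \<open>auto intro: gN\<close>)
    then show "x \<in> V N" using * V submodule_add by blast
  qed
  moreover have "s ^ N \<in> U" using V_power[of N "Suc N"] by (auto simp: U_def)
  ultimately have "s ^ N \<in> V N" by blast
  then obtain c i where c: "\<forall>j\<in>{..<N}. c j \<in> R" "i \<in> I" "s ^ N = (\<Sum>j<N. c j * s ^ j) + i"
    unfolding V_def by (elim gspanE)
  \<comment> \<open>Multiply the integral equation by \<open>t ^ Suc N\<close>. Modulo
    \<open>I\<close> its left side becomes \<open>t\<close>, and \<open>t ^ Suc N * s ^ j\<close>
    becomes \<open>t ^ (N - j) * t\<close>, which contains \<open>t * t\<close> because
    \<open>j < N\<close>.\<close>
  define h where "h = (\<Sum>j<N. c j * t ^ (N - Suc j))"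
  have "h \<in> T"
    unfolding h_def using c(1) T t
    by (intro submodule_sum[OF submodule_subring[OF T(1)]] subring_mult[OF T(1)] subring_power[OF T(1)]) auto
  have "(\<Sum>j<N. c j * t ^ (N - j) * (t ^ Suc j * s ^ j - t)) \<in> I"
    by (rule submodule_sum[OF I(1)], rule submodule_mult[OF I(1) UNIV_I regular_mod_power[OF I(1) s]])
  moreover have "(\<Sum>j<N. c j * t ^ (N - j) * (t ^ Suc j * s ^ j - t)) = t ^ Suc N * (s ^ N - i) - t * t * h"
  proof -
    have "c j * t ^ (N - j) * (t ^ Suc j * s ^ j - t) = t ^ Suc N * (c j * s ^ j) - t * t * (c j * t ^ (N - Suc j))"
      if "j < N" for j
    proof -
      have e1: "t ^ (N - j) = t * t ^ (N - Suc j)"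
        using that by (metis Suc_diff_Suc power_Suc)
      have e2: "t ^ Suc N = t ^ (N - j) * t ^ Suc j"
        using that by (simp flip: power_add del: power_Suc)
      show ?thesis unfolding e2 by (simp add: e1 algebra_simps)
    qed
    then have "(\<Sum>j<N. c j * t ^ (N - j) * (t ^ Suc j * s ^ j - t))
        = (\<Sum>j<N. t ^ Suc N * (c j * s ^ j) - t * t * (c j * t ^ (N - Suc j)))"
      by (intro sum.cong) auto
    also have "\<dots> = t ^ Suc N * (\<Sum>j<N. c j * s ^ j) - t * t * h"
      by (simp only: h_def sum_subtractf sum_distrib_left)
    also have "(\<Sum>j<N. c j * s ^ j) = s ^ N - i" using c(3) by simp
    finally show ?thesis .
  qed
  ultimately have h1: "t ^ Suc N * (s ^ N - i) - t * t * h \<in> I" by simp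
  have h2: "t ^ Suc N * s ^ N - t \<in> I" by (rule regular_mod_power[OF I(1) s])
  have h3: "t ^ Suc N * i \<in> I" by (rule submodule_mult[OF I(1) UNIV_I c(2)])
  have "t - t * t * h \<in> I"
    using submodule_diff[OF I(1) submodule_add[OF I(1) h1 h3] h2] by (simp add: algebra_simps)
  then show "\<exists>b\<in>T. t - t * t * b \<in> I" using \<open>h \<in> T\<close> by blast
qed

text \<open>Ideals of \<open>T\<close> containing \<open>I\<close> are finitely generated modulo
  \<open>I\<close> even over \<open>R\<close>, so regularity of \<open>T/I\<close> gives
  semisimplicity.\<close>

lemma semisimple_mod_intermediate:
  fixes R :: "'a::comm_ring_1 set"
  assumes R: "is_subring R" and I: "submodule UNIV I" "I \<subseteq> R" and ss: "semisimple_mod R I"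
    and fin: "finite_ext R" and reg: "regular_mod UNIV I" and T: "is_subring T" "R \<subseteq> T"
  shows "semisimple_mod T I"
proof (rule semisimple_mod_if_regular[OF T(1) I(1) regular_mod_intermediate[OF assms]])
  fix P assume P: "submodule T P" "P \<subseteq> T" "I \<subseteq> P"
  obtain F :: "'a set" and g where F: "finite F" "range g \<subseteq> P" "P \<subseteq> gspan R g F I"
    by (rule finite_gen_submodule[OF R I ss fin submodule_antimono[OF P(1) T(2)] P(3)])
  have "gspan R g F I \<subseteq> gspan T g F I" using T(2) unfolding gspan_def by blast
  then show "\<exists>(F :: 'a set) g. finite F \<and> (\<forall>x\<in>F. g x \<in> P) \<and> P \<subseteq> gspan T g F I"
    using F by (intro exI[of _ F] exI[of _ g]) auto
qed

text \<open>The idempotent generating the union of the chain modulo \<open>I\<close> already lies in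
  one member.\<close>

lemma semisimple_mod_ascending:
  assumes ss: "semisimple_mod UNIV I" and P: "\<And>n::nat. submodule UNIV (P n)" "\<And>n. I \<subseteq> P n" "\<And>n. P n \<subseteq> P (Suc n)"
  shows "\<exists>n. P (Suc n) = P n"
proof -
  define U where "U = (\<Union>n. P n)"
  have mono: "P n \<subseteq> P m" if "n \<le> m" for n m using P(3) that by (rule lift_Suc_mono_le)
  have "submodule UNIV U"
    unfolding U_def by (rule submodule_UN[OF P(1) mono])
  moreover have "I \<subseteq> U" using P(2) by (auto simp: U_def)
  ultimately obtain e where e: "e \<in> U" "\<And>p. p \<in> U \<Longrightarrow> p - p * e \<in> I"
    using ss[unfolded semisimple_mod_def, rule_format, of U] by auto
  then obtain n where n: "e \<in> P n" by (auto simp: U_def)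
  have "p \<in> P n" if "p \<in> P (Suc n)" for p
  proof -
    have "p - p * e \<in> P n" using e(2)[of p] that P(2) by (auto simp: U_def)
    then show ?thesis using submodule_mem_cong[OF P(1)] submodule_mult[OF P(1) UNIV_I n] by blast
  qed
  then show ?thesis using P(3)[of n] by blast
qed

section \<open>Counting the ideals of a semisimple quotient\<close>

lemma submodule_set_sum:
  assumes "submodule R P" "submodule R Q"
  shows "submodule R {p + q | p q. p \<in> P \<and> q \<in> Q}"
  unfolding submodule_def
proof (intro conjI ballI)
  show "0 \<in> {p + q | p q. p \<in> P \<and> q \<in> Q}"
    using assms[THEN submodule_0] by (intro CollectI exI[of _ 0]) simp
next
  fix x y assume "x \<in> {p + q | p q. p \<in> P \<and> q \<in> Q}" "y \<in> {p + q | p q. p \<in> P \<and> q \<in> Q}"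
  then obtain p q p' q' where *: "x = p + q" "y = p' + q'" "p \<in> P" "q \<in> Q" "p' \<in> P" "q' \<in> Q" by blast
  have "x + y = (p + p') + (q + q')" "x - y = (p - p') + (q - q')" using * by (simp_all add: algebra_simps)
  then show "x + y \<in> {p + q | p q. p \<in> P \<and> q \<in> Q}" "x - y \<in> {p + q | p q. p \<in> P \<and> q \<in> Q}"
    using * assms submodule_add submodule_diff by blast+
next
  fix r x assume "r \<in> R" "x \<in> {p + q | p q. p \<in> P \<and> q \<in> Q}"
  then obtain p q where *: "x = p + q" "p \<in> P" "q \<in> Q" by blast
  have "r * x = r * p + r * q" using * by (simp add: algebra_simps)
  then show "r * x \<in> {p + q | p q. p \<in> P \<and> q \<in> Q}"
    using * \<open>r \<in> R\<close> assms submodule_mult by blast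
qed

lemma set_sum_upper:
  assumes "submodule R P" "submodule R Q"
  shows "P \<subseteq> {p + q | p q. p \<in> P \<and> q \<in> Q}" "Q \<subseteq> {p + q | p q. p \<in> P \<and> q \<in> Q}"
proof safe
  fix x
  show "\<exists>p q. x = p + q \<and> p \<in> P \<and> q \<in> Q" if "x \<in> P"
    using that submodule_0[OF assms(2)] by (intro exI[of _ x] exI[of _ 0]) simp
  show "\<exists>p q. x = p + q \<and> p \<in> P \<and> q \<in> Q" if "x \<in> Q"
    using that submodule_0[OF assms(1)] by (intro exI[of _ 0] exI[of _ x]) simp
qed

text \<open>Noetherian induction on \<open>J\<close> for the ideals above \<open>J\<close>. A proper
  ideal \<open>L\<close> strictly above \<open>J\<close> yields, through its idempotent, a second
  one \<open>M\<close>, and each \<open>P\<close> above \<open>J\<close> is the intersection of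
  \<open>P + L\<close> and \<open>P + M\<close>.\<close>

lemma finite_ideals_if_semisimple:
  assumes I: "submodule UNIV I" and ss: "semisimple_mod UNIV I"
  shows "finite {P. submodule UNIV P \<and> I \<subseteq> P}"
proof -
  define X where "X J = {P. submodule UNIV P \<and> J \<subseteq> P}" for J :: "'a set"
  \<comment> \<open>Larger ideals count as smaller, so well-foundedness is the ascending chain
    condition.\<close>
  define r where "r = {(L, J). J \<in> X I \<and> L \<in> X I \<and> J \<subset> L}"
  have "wf r"
    unfolding wf_iff_no_infinite_down_chain
  proof
    assume "\<exists>f. \<forall>i. (f (Suc i), f i) \<in> r"
    then obtain f where f: "\<And>i. (f (Suc i), f i) \<in> r" by blast
    then have "\<exists>n. f (Suc n) = f n"
      by (intro semisimple_mod_ascending[OF ss]) (auto simp: r_def X_def)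
    then show False using f by (auto simp: r_def)
  qed
  then have "J \<in> X I \<Longrightarrow> finite (X J)" for J
  proof (induction J rule: wf_induct_rule)
    case (less J)
    have J: "submodule UNIV J" "I \<subseteq> J" using less.prems by (auto simp: X_def)
    have IH: "finite (X L)" if "submodule UNIV L" "J \<subset> L" for L
      using that J less by (auto simp: r_def X_def)
    show ?case
    proof (cases "\<exists>L. submodule UNIV L \<and> J \<subset> L \<and> L \<noteq> UNIV")
      case False
      then have "X J \<subseteq> {J, UNIV}" by (auto simp: X_def)
      then show ?thesis by (rule finite_subset) simp
    next
      case True
      then obtain L where L: "submodule UNIV L" "J \<subset> L" "L \<noteq> UNIV" by blast
      obtain e where e: "e \<in> L" "\<And>p. p \<in> L \<Longrightarrow> p - p * e \<in> I"
        using ss[unfolded semisimple_mod_def, rule_format, of L] L(1,2) J by blast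
      define M where "M = {j + x * (1 - e) | j x. j \<in> J \<and> x \<in> UNIV}"
      have M: "submodule UNIV M" unfolding M_def by (rule submodule_adjoin[OF subring_UNIV J(1)])
      have "J \<subseteq> M"
      proof
        fix j assume "j \<in> J"
        then show "j \<in> M" unfolding M_def by (intro CollectI exI[of _ j] exI[of _ 0]) simp
      qed
      moreover have "1 - e \<in> M"
        unfolding M_def using submodule_0[OF J(1)] by (intro CollectI exI[of _ 0] exI[of _ 1]) simp
      moreover have "1 - e \<notin> J"
      proof
        assume "1 - e \<in> J"
        then have "1 - e + e \<in> L" using L e submodule_add by blast
        then have "x \<in> L" for x using submodule_mult[OF L(1) UNIV_I, of 1 x] by simp
        then show False using L(3) by blast
      qed
      ultimately have JM: "J \<subset> M" by blast
      define S where "S P Q = {p + q | p q. p \<in> P \<and> q \<in> Q}" for P Q :: "'a set"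
      have "inj_on (\<lambda>P. (S P L, S P M)) (X J)"
      proof (rule inj_on_inverseI[where g="\<lambda>(A, B). A \<inter> B"])
        fix P assume "P \<in> X J"
        then have P: "submodule UNIV P" "J \<subseteq> P" by (auto simp: X_def)
        have "x \<in> P" if x: "x \<in> S P L" "x \<in> S P M" for x
        proof -
          obtain p q where pq: "x = p + q" "p \<in> P" "q \<in> L" using x(1) by (auto simp: S_def)
          obtain p' j y where pm: "x = p' + (j + y * (1 - e))" "p' \<in> P" "j \<in> J"
            using x(2) by (auto simp: S_def M_def)
          have i: "e - e * e \<in> P" "q - q * e \<in> P" using e pq J(2) P(2) by auto
          \<comment> \<open>Split \<open>x\<close> as \<open>x * e + x * (1 - e)\<close>. The first
            part is in \<open>P\<close> since \<open>e\<close> kills \<open>1 - e\<close> modulo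
            \<open>I\<close>, the second since \<open>1 - e\<close> kills \<open>L\<close> modulo
            \<open>I\<close>.\<close>
          have "(p' + j) * e + y * (e - e * e) + (p * (1 - e) + (q - q * e)) \<in> P"
            using pm pq P i
            by (intro submodule_add[OF P(1)] submodule_mult[OF P(1) UNIV_I] submodule_mult_right[OF P(1) UNIV_I]) auto
          also have "(p' + j) * e + y * (e - e * e) + (p * (1 - e) + (q - q * e)) = x * e + x * (1 - e)"
            by (subst pm(1), subst pq(1)) (simp add: algebra_simps)
          finally show ?thesis by (simp add: algebra_simps)
        qed
        moreover have "P \<subseteq> S P L" "P \<subseteq> S P M"
          unfolding S_def using set_sum_upper P(1) L(1) M by blast+
        ultimately show "(case (S P L, S P M) of (A, B) \<Rightarrow> A \<inter> B) = P" by auto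
      qed
      moreover have "(\<lambda>P. (S P L, S P M)) ` X J \<subseteq> X L \<times> X M"
      proof (rule image_subsetI)
        fix P assume "P \<in> X J"
        then have "submodule UNIV P" by (simp add: X_def)
        then have "S P L \<in> X L" "S P M \<in> X M"
          unfolding S_def X_def using submodule_set_sum set_sum_upper(2) L(1) M by blast+
        then show "(S P L, S P M) \<in> X L \<times> X M" by simp
      qed
      ultimately show ?thesis
        using IH[OF L(1,2)] IH[OF M JM] by (meson finite_SigmaI finite_imageD finite_subset)
    qed
  qed
  then show ?thesis using I by (auto simp: X_def)
qed

section \<open>Base change and FIP\<close>

lemma pm_ext_sum:
  assumes J: "submodule R J" and b: "additive_mod J b"
  shows "pm_ext b (sum f K) - (\<Sum>k\<in>K. pm_ext b (f k)) \<in> J"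
proof (induction K rule: infinite_finite_induct)
  case (insert k K)
  then show ?case
    using submodule_add[OF J pm_ext_add[OF J b, of "f k" "sum f K"] insert.IH] by (simp add: algebra_simps)
qed (use submodule_0[OF J] in auto)

lemma tensor_relations_single_ideal:
  "i \<in> I \<Longrightarrow> Poly_Mapping.single m i \<in> tensor_relations R I"
  using tensor_relations.ideal_rel[OF _ tensor_relations.zero, of i I "unmul m" R] by simp

lemma tensor_relations_single_cong:
  assumes I: "submodule UNIV I" "I \<subseteq> R" and xy: "x - y \<in> I"
  shows "Poly_Mapping.single (Mul x) c - Poly_Mapping.single (Mul y) c \<in> tensor_relations R I"
proof -
  note N = submodule_tensor_relations[OF I(1), of R]
  have "Poly_Mapping.single (Mul ((x - y) * 1)) c - Poly_Mapping.single (Mul 1) ((x - y) * c) + 0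
      \<in> tensor_relations R I"
    using xy I(2) by (intro tensor_relations.balance_rel tensor_relations.zero) auto
  moreover have "Poly_Mapping.single (Mul 1) ((x - y) * c) \<in> tensor_relations R I"
    by (intro tensor_relations_single_ideal submodule_mult_right[OF I(1) UNIV_I xy])
  ultimately have "Poly_Mapping.single (Mul (x - y)) c \<in> tensor_relations R I"
    using submodule_mem_cong[OF N] by simp
  then have "Poly_Mapping.single (Mul (x - y + y)) c - Poly_Mapping.single (Mul (x - y)) c
      - Poly_Mapping.single (Mul y) c + Poly_Mapping.single (Mul (x - y)) c \<in> tensor_relations R I"
    by (rule tensor_relations.add_rel)
  then show ?thesis by simp
qed

lemma tensor_right_ideal:
  assumes "submodule UNIV I" "I \<subseteq> R" "i \<in> I"
  shows "tensor_right i \<in> tensor_relations R I"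
  using submodule_mem_cong[OF submodule_tensor_relations[OF assms(1)] tensor_relations_right_left
    tensor_relations_left[OF assms(3)]] assms by blast

lemma tensor_right_sum:
  assumes I: "submodule UNIV I" "I \<subseteq> R"
  shows "tensor_right (sum f K) - (\<Sum>k\<in>K. tensor_right (f k)) \<in> tensor_relations R I"
proof (induction K rule: infinite_finite_induct)
  case (insert k K)
  then show ?case
    using submodule_add[OF submodule_tensor_relations[OF I(1)]
        tensor_relations_right_add[of "f k" "sum f K"] insert.IH] by (simp add: algebra_simps)
qed (use tensor_right_ideal[OF I submodule_0[OF I(1)]] in auto)

text \<open>The ring \<open>S \<otimes> 1\<close> enlarged by the relations: the separability lemmas
  are reused with it as base ring, and they want the ideal to lie inside the base.\<close>

definition left_subring :: "'a::comm_ring_1 set \<Rightarrow> 'a set \<Rightarrow> 'a tensor set" where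
  "left_subring R I = {tensor_left s + n | s n. n \<in> tensor_relations R I}"

lemma left_subringI:
  "w - tensor_left s \<in> tensor_relations R I \<Longrightarrow> w \<in> left_subring R I"
  unfolding left_subring_def by (intro CollectI exI[of _ s] exI[of _ "w - tensor_left s"]) simp

lemma left_subring:
  assumes I: "submodule UNIV I"
  shows "is_subring (left_subring R I)" "tensor_relations R I \<subseteq> left_subring R I"
proof -
  let ?N = "tensor_relations R I"
  note N = submodule_tensor_relations[OF I, of R]
  show sub: "?N \<subseteq> left_subring R I"
    by (rule subsetI, rule left_subringI[where s=0]) (simp add: tensor_left_0)
  show "is_subring (left_subring R I)"
    unfolding is_subring_def
  proof (intro conjI ballI)
    show "0 \<in> left_subring R I" using sub submodule_0[OF N] by blast
    show "1 \<in> left_subring R I"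
      using submodule_0[OF N] by (intro left_subringI[where s=1]) (simp add: tensor_left_1)
  next
    fix v w assume "v \<in> left_subring R I" "w \<in> left_subring R I"
    then obtain s n t m where *: "v = tensor_left s + n" "w = tensor_left t + m" "n \<in> ?N" "m \<in> ?N"
      by (auto simp: left_subring_def)
    show "v + w \<in> left_subring R I"
      using submodule_add[OF N *(3,4)]
      by (intro left_subringI[where s="s + t"]) (simp add: * tensor_left_add algebra_simps)
    show "v - w \<in> left_subring R I"
      using submodule_diff[OF N *(3,4)]
      by (intro left_subringI[where s="s - t"]) (simp add: * tensor_left_diff algebra_simps)
    have "tensor_left s * m + n * w \<in> ?N"
      by (intro submodule_add[OF N] submodule_mult[OF N UNIV_I] submodule_mult_right[OF N UNIV_I] *)
    then show "v * w \<in> left_subring R I"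
      by (intro left_subringI[where s="s * t"]) (simp add: * tensor_left_mult algebra_simps)
  qed
qed

text \<open>Modulo the relations this ring is the image of \<open>S\<close>, so ideals are pulled
  back along \<open>tensor_left\<close> and the idempotent is pushed forward.\<close>

lemma semisimple_mod_left_subring:
  assumes I: "submodule UNIV I" and ss: "semisimple_mod UNIV I"
  shows "semisimple_mod (left_subring R I) (tensor_relations R I)"
  unfolding semisimple_mod_def
proof (intro allI impI)
  let ?N = "tensor_relations R I"
  note N = submodule_tensor_relations[OF I, of R]
  fix P assume "submodule (left_subring R I) P \<and> P \<subseteq> left_subring R I \<and> ?N \<subseteq> P"
  then have P: "submodule (left_subring R I) P" "P \<subseteq> left_subring R I" "?N \<subseteq> P" by auto
  have left: "tensor_left s \<in> left_subring R I" for s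
    using submodule_0[OF N] by (intro left_subringI[where s=s]) simp
  define Q where "Q = {s. tensor_left s \<in> P}"
  have "submodule UNIV Q"
    unfolding submodule_def Q_def
    using submodule_0[OF P(1)] submodule_add[OF P(1)] submodule_diff[OF P(1)] submodule_mult[OF P(1) left]
    by (simp add: tensor_left_0 tensor_left_add tensor_left_diff tensor_left_mult)
  moreover have "I \<subseteq> Q" using tensor_relations_left P(3) by (auto simp: Q_def)
  ultimately obtain e where e: "e \<in> Q" "\<And>q. q \<in> Q \<Longrightarrow> q - q * e \<in> I"
    using ss[unfolded semisimple_mod_def, rule_format, of Q] by auto
  have "p - p * tensor_left e \<in> ?N" if "p \<in> P" for p
  proof -
    obtain s n where *: "p = tensor_left s + n" "n \<in> ?N" using subsetD[OF P(2) \<open>p \<in> P\<close>] by (auto simp: left_subring_def)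
    have "p - n \<in> P" using that * P(3) by (intro submodule_diff[OF P(1)]) auto
    then have "s \<in> Q" using * by (simp add: Q_def)
    then have "tensor_left (s - s * e) + n * (1 - tensor_left e) \<in> ?N"
      using e(2) * by (intro submodule_add[OF N] submodule_mult_right[OF N UNIV_I] tensor_relations_left)
    then show ?thesis by (simp add: * tensor_left_diff tensor_left_mult algebra_simps)
  qed
  then show "\<exists>e\<in>P. \<forall>p\<in>P. p - p * e \<in> ?N" using e(1) by (auto simp: Q_def)
qed

text \<open>Over its left factor the tensor square is a base change of \<open>S/I\<close>. The
  separability element is the image \<open>E\<close> of \<open>D\<close> under \<open>c \<otimes> x
  \<mapsto> (1 \<otimes> c) \<otimes> (1 \<otimes> x)\<close>.\<close>

lemma separable_mod_base_change:
  fixes R :: "'a::comm_ring_1 set"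
  assumes I: "submodule UNIV I" "I \<subseteq> R" and sep: "separable_mod R I"
  shows "separable_mod (left_subring R I) (tensor_relations R I)"
proof -
  obtain D where D: "pm_ext (\<lambda>c m. c * unmul m) D - 1 \<in> I"
    "\<And>s. (tensor_right s - tensor_left s) * D \<in> tensor_relations R I"
    using sep unfolding separable_mod_def by blast
  define N where "N = tensor_relations R I"
  define A where "A = left_subring R I"
  have N: "submodule UNIV N" unfolding N_def by (rule submodule_tensor_relations[OF I(1)])
  have A: "is_subring A" "N \<subseteq> A" unfolding A_def N_def by (rule left_subring[OF I(1)])+
  define J where "J = tensor_relations A N"
  have J: "submodule UNIV J" unfolding J_def by (rule submodule_tensor_relations[OF N])
  define b where "b = (\<lambda>u (m :: 'a mul). Poly_Mapping.single (Mul (tensor_right (unmul m))) (tensor_right u :: 'a tensor))"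
  have single_N: "Poly_Mapping.single m n \<in> J" if "n \<in> N" for m n
    unfolding J_def by (rule tensor_relations_single_ideal[OF that])
  have b_add: "additive_mod J b"
    unfolding additive_mod_def
  proof (intro allI)
    fix x y m
    have "Poly_Mapping.single (Mul (tensor_right (unmul m))) (tensor_right (x + y) - (tensor_right x + tensor_right y)) \<in> J"
      using tensor_relations_right_add by (intro single_N) (simp add: N_def)
    then show "b (x + y) m - (b x m + b y m) \<in> J"
      by (simp add: b_def single_diff single_add)
  qed
  have b_rel: "pm_ext b w \<in> J" if "w \<in> N" for w
    using that unfolding N_def
  proof (rule pm_ext_tensor_relations[OF _ J b_add])
    fix c x y
    let ?s = "\<lambda>z. Poly_Mapping.single (Mul z) (tensor_right c) :: 'a tensor tensor"
    have h1: "?s (tensor_right (x + y)) - ?s (tensor_right x + tensor_right y) \<in> J"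
      unfolding J_def using tensor_relations_right_add
      by (intro tensor_relations_single_cong[OF N A(2)]) (simp add: N_def)
    have h2: "?s (tensor_right x + tensor_right y) - ?s (tensor_right x) - ?s (tensor_right y) + 0 \<in> J"
      unfolding J_def by (intro tensor_relations.add_rel tensor_relations.zero)
    show "b c (Mul (x + y)) - (b c (Mul x) + b c (Mul y)) \<in> J"
      using submodule_add[OF J h1 h2] by (simp add: b_def algebra_simps)
  next
    fix r c x assume "r \<in> R"
    then have "tensor_right r \<in> A"
      unfolding A_def by (intro left_subringI[where s=r] tensor_relations_right_left)
    then have "Poly_Mapping.single (Mul (tensor_right r * tensor_right x)) (tensor_right c)
        - Poly_Mapping.single (Mul (tensor_right x)) (tensor_right r * tensor_right c) + 0 \<in> J"
      unfolding J_def by (intro tensor_relations.balance_rel tensor_relations.zero)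
    then show "b c (Mul (r * x)) - b (r * c) (Mul x) \<in> J"
      by (simp add: b_def tensor_right_mult)
  next
    fix i x assume "i \<in> I"
    then show "b i (Mul x) \<in> J"
      unfolding b_def using tensor_right_ideal[OF I] by (intro single_N) (simp add: N_def)
  qed
  define E where "E = pm_ext b D"
  have diag_right: "E * (tensor_right (tensor_right s) - tensor_left (tensor_right s)) \<in> J" for s
  proof -
    have r: "pm_ext (\<lambda>u m. b u (m + Mul s)) D = E * tensor_right (tensor_right s)"
      by (simp add: E_def pm_ext_def sum_distrib_right b_def plus_mul_def tensor_right_def[of "tensor_right s"]
          mult_single tensor_right_mult)
    have l: "pm_ext (\<lambda>u m. b (u * s) m) D = E * tensor_left (tensor_right s)"
      by (simp add: E_def pm_ext_def sum_distrib_right b_def tensor_left_def mult_single tensor_right_mult)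
    have h1: "pm_ext b (D * tensor_right s) - E * tensor_right (tensor_right s) \<in> J"
      using pm_ext_mult_single[OF J b_add, of D "Mul s" 1, folded tensor_right_def] by (simp add: r)
    have h2: "pm_ext b (D * tensor_left s) - E * tensor_left (tensor_right s) \<in> J"
      using pm_ext_mult_single[OF J b_add, of D 0 s, folded tensor_left_def] by (simp add: l)
    have h3: "pm_ext b (D * tensor_right s - D * tensor_left s)
        - (pm_ext b (D * tensor_right s) - pm_ext b (D * tensor_left s)) \<in> J"
      by (rule pm_ext_diff[OF J b_add])
    have h4: "pm_ext b (D * tensor_right s - D * tensor_left s) \<in> J"
      using b_rel[of "D * tensor_right s - D * tensor_left s"] D(2)[of s] by (simp add: N_def algebra_simps)
    show ?thesis
      using submodule_diff[OF J submodule_diff[OF J h2 h1] submodule_diff[OF J h3 h4]]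
      by (simp add: algebra_simps)
  qed
  have diag: "(tensor_right w - tensor_left w) * E \<in> J" for w
  proof -
    \<comment> \<open>The annihilator of \<open>E\<close> modulo \<open>J\<close>. The equaliser
      \<open>Z\<close> modulo \<open>L\<close> contains all \<open>s \<otimes> 1\<close>, which lie
      in the base ring, and all \<open>1 \<otimes> s\<close> by \<open>diag_right\<close>; together
      these generate the tensor square.\<close>
    define L where "L = {z. E * z \<in> J}"
    have L: "submodule UNIV L"
      using J by (auto simp: L_def submodule_def distrib_left right_diff_distrib mult.left_commute)
    have JL: "tensor_relations A N \<subseteq> L"
      using submodule_mult[OF J UNIV_I] by (auto simp: L_def J_def)
    define Z where "Z = {w. tensor_right w - tensor_left w \<in> L}"
    have Z: "is_subring Z" "A \<subseteq> Z" unfolding Z_def by (rule coincidence_subring[OF A(1) L JL])+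
    have left: "tensor_left s \<in> Z" for s
    proof -
      have "tensor_left s \<in> A"
        unfolding A_def using tensor_relations.zero by (intro left_subringI[where s=s]) simp
      then show ?thesis using Z(2) by blast
    qed
    have right: "tensor_right s \<in> Z" for s
      using diag_right by (simp add: Z_def L_def)
    have "w \<in> Z"
      by (subst poly_mapping_eq_sum_single, unfold single_eq_tensor,
          rule submodule_sum[OF submodule_subring[OF Z(1)]], rule subring_mult[OF Z(1) left right])
    then show ?thesis by (simp add: Z_def L_def mult.commute)
  qed
  let ?\<mu> = "\<lambda>c m. c * unmul m"
  have add: "additive_mod N ?\<mu>"
    using submodule_0[OF N] by (simp add: additive_mod_def algebra_simps)
  \<comment> \<open>Multiplication takes \<open>E\<close> to \<open>1 \<otimes> d\<close>, where
    \<open>d\<close> is the value for \<open>D\<close> and is congruent to 1 modulo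
    \<open>I\<close>.\<close>
  have "pm_ext ?\<mu> E - 1 \<in> N"
  proof -
    let ?K = "Poly_Mapping.keys D" and ?d = "Poly_Mapping.lookup D"
    have h1: "pm_ext ?\<mu> E - (\<Sum>k\<in>?K. pm_ext ?\<mu> (b (?d k) k)) \<in> N"
      unfolding E_def pm_ext_def[of b] by (rule pm_ext_sum[OF N add])
    have "(\<Sum>k\<in>?K. pm_ext ?\<mu> (b (?d k) k) - tensor_right (?d k * unmul k)) \<in> N"
    proof (rule submodule_sum[OF N])
      fix k
      show "pm_ext ?\<mu> (b (?d k) k) - tensor_right (?d k * unmul k) \<in> N"
        using pm_ext_single[OF N add, of "Mul (tensor_right (unmul k))" "tensor_right (?d k)"]
        by (simp add: b_def tensor_right_mult)
    qed
    then have h2: "(\<Sum>k\<in>?K. pm_ext ?\<mu> (b (?d k) k)) - (\<Sum>k\<in>?K. tensor_right (?d k * unmul k)) \<in> N"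
      by (simp add: sum_subtractf)
    have h3: "(\<Sum>k\<in>?K. tensor_right (?d k * unmul k)) - tensor_right (pm_ext ?\<mu> D) \<in> N"
      unfolding pm_ext_def N_def
      by (rule submodule_sym[OF submodule_tensor_relations[OF I(1)] tensor_right_sum[OF I]])
    define i where "i = pm_ext ?\<mu> D - 1"
    have "tensor_right (i + 1) - (tensor_right i + tensor_right 1) \<in> N"
      unfolding N_def by (rule tensor_relations_right_add)
    moreover have "tensor_right i \<in> N"
      unfolding N_def i_def by (rule tensor_right_ideal[OF I D(1)])
    ultimately have h4: "tensor_right (pm_ext ?\<mu> D) - 1 \<in> N"
      using submodule_add[OF N] by (fastforce simp: i_def tensor_right_1)
    show ?thesis
      using submodule_trans[OF N submodule_trans[OF N h1 h2] submodule_trans[OF N h3 h4]] .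
  qed
  then show ?thesis
    using diag unfolding separable_mod_def J_def A_def N_def by blast
qed

text \<open>An intermediate ring \<open>T\<close> is sent to the kernel
  \<open>tensor_relations T I\<close>, one of finitely many ideals above
  \<open>tensor_relations R I\<close>, and is recovered as the set of \<open>a\<close> with
  \<open>1 \<otimes> a - a \<otimes> 1\<close> in that kernel.\<close>

lemma fip_ext_if_separable:
  fixes R :: "'a::comm_ring_1 set"
  assumes R: "is_subring R" and I: "submodule UNIV I" "I \<subseteq> R" and ss: "semisimple_mod R I"
    and sep: "separable_mod R I"
  shows "fip_ext R"
proof -
  have ssS: "semisimple_mod UNIV I" by (rule semisimple_mod_if_separable[OF assms])
  have reg: "regular_mod UNIV I" by (rule regular_mod_if_semisimple[OF subring_UNIV I(1) subset_UNIV ssS])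
  have fin: "finite_ext R" by (rule finite_ext_if_separable[OF assms])
  note N = submodule_tensor_relations[OF I(1), of R]
  have "semisimple_mod UNIV (tensor_relations R I)"
    by (rule semisimple_mod_if_separable[OF left_subring(1)[OF I(1)] N left_subring(2)[OF I(1)]
      semisimple_mod_left_subring[OF I(1) ssS] separable_mod_base_change[OF I sep]])
  then have finite: "finite {P. submodule UNIV P \<and> tensor_relations R I \<subseteq> P}"
    by (rule finite_ideals_if_semisimple[OF N])
  let ?X = "{T. is_subring T \<and> R \<subseteq> T}"
  have "inj_on (\<lambda>T. tensor_relations T I) ?X"
  proof (rule inj_on_inverseI[where g="\<lambda>M. {a. tensor_right a - tensor_left a \<in> M}"])
    fix T assume "T \<in> ?X"
    then have T: "is_subring T" "R \<subseteq> T" by auto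
    have IT: "I \<subseteq> T" using I(2) T(2) by blast
    obtain \<pi> where \<pi>: "linear_mod T I \<pi>" "\<And>x. \<pi> x \<in> T" "\<And>x. x \<in> T \<Longrightarrow> \<pi> x - x \<in> I"
      using linear_projection_exists[OF T(1) I(1) IT semisimple_mod_intermediate[OF R I ss fin reg T]
          submodule_subring[OF T(1)] IT] by blast
    \<comment> \<open>\<open>\<phi>\<close> vanishes on \<open>T\<close> modulo \<open>I\<close>.
      The map \<open>c \<otimes> x \<mapsto> c * \<phi> x\<close> is well defined over
      \<open>T\<close> and takes \<open>1 \<otimes> a - a \<otimes> 1\<close> to
      \<open>\<phi> a\<close> modulo \<open>I\<close>; hence \<open>a\<close> and
      \<open>\<pi> a\<close> agree modulo \<open>I\<close>.\<close>
    define \<phi> where "\<phi> x = x - \<pi> x" for x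
    have \<phi>: "linear_mod T I \<phi>"
      unfolding linear_mod_def
    proof (intro conjI allI ballI)
      fix x y
      have "\<pi> (x + y) - (\<pi> x + \<pi> y) \<in> I" using \<pi>(1) unfolding linear_mod_def by blast
      from submodule_uminus[OF I(1) this] show "\<phi> (x + y) - (\<phi> x + \<phi> y) \<in> I"
        by (simp add: \<phi>_def algebra_simps)
    next
      fix r x assume "r \<in> T"
      then have "\<pi> (r * x) - r * \<pi> x \<in> I" using \<pi>(1) unfolding linear_mod_def by blast
      from submodule_uminus[OF I(1) this] show "\<phi> (r * x) - r * \<phi> x \<in> I"
        by (simp add: \<phi>_def algebra_simps)
    qed
    let ?b = "\<lambda>c m. c * \<phi> (unmul m * 1)"
    have b: "additive_mod I ?b"
      using submodule_0[OF I(1)] by (simp add: additive_mod_def algebra_simps)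
    have "a \<in> T" if a: "tensor_right a - tensor_left a \<in> tensor_relations T I" for a
    proof -
      have h1: "pm_ext ?b (tensor_right a - tensor_left a) \<in> I"
        by (rule pm_ext_linear_tensor_relations[OF I(1) \<phi> a])
      have h2: "pm_ext ?b (tensor_right a - tensor_left a) - (pm_ext ?b (tensor_right a) - pm_ext ?b (tensor_left a)) \<in> I"
        by (rule pm_ext_diff[OF I(1) b])
      have h3: "pm_ext ?b (tensor_right a) - \<phi> a \<in> I"
        using pm_ext_single[OF I(1) b, of "Mul a" 1] by (simp add: tensor_right_def)
      have h4: "pm_ext ?b (tensor_left a) - a * \<phi> 1 \<in> I"
        using pm_ext_single[OF I(1) b, of 0 a] by (simp add: tensor_left_def zero_mul_def)
      have "1 - \<pi> 1 \<in> I" using submodule_sym[OF I(1) \<pi>(3)[OF subring_1[OF T(1)]]] .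
      then have h5: "a * \<phi> 1 \<in> I" by (simp add: \<phi>_def submodule_mult[OF I(1)])
      have "\<phi> a \<in> I"
        using submodule_add[OF I(1) submodule_diff[OF I(1) submodule_add[OF I(1) submodule_diff[OF I(1) h1 h2] h4] h3] h5]
        by (simp add: algebra_simps)
      then have "\<phi> a + \<pi> a \<in> T" using IT \<pi>(2) by (intro subring_add[OF T(1)]) auto
      then show ?thesis by (simp add: \<phi>_def)
    qed
    then show "{a. tensor_right a - tensor_left a \<in> tensor_relations T I} = T"
      using tensor_relations_right_left by blast
  qed
  moreover have "(\<lambda>T. tensor_relations T I) ` ?X \<subseteq> {P. submodule UNIV P \<and> tensor_relations R I \<subseteq> P}"
    using submodule_tensor_relations[OF I(1)] tensor_relations_mono by blast
  ultimately show ?thesis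
    unfolding fip_ext_def using finite by (meson finite_imageD finite_subset)
qed

section \<open>The nucleus\<close>

lemma conductor_submodule:
  assumes R: "is_subring R"
  shows "submodule UNIV (conductor R)" "conductor R \<subseteq> R"
proof -
  show "conductor R \<subseteq> R" by (auto simp: conductor_def)
  show "submodule UNIV (conductor R)"
    unfolding submodule_def conductor_def
  proof (intro conjI ballI CollectI)
    fix r x assume x: "x \<in> {r \<in> R. \<forall>s. r * s \<in> R}"
    then show "r * x \<in> R" by (simp add: mult.commute[of r])
    show "\<forall>s. r * x * s \<in> R"
    proof
      fix s
      have "x * (r * s) \<in> R" using x by blast
      then show "r * x * s \<in> R" by (simp add: ac_simps)
    qed
  qed (use R in \<open>auto simp: distrib_right left_diff_distrib subring_0 subring_add subring_diff\<close>)
qed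

text \<open>If \<open>b * b\<close> is in the conductor, the square and cube of each
  \<open>b * s\<close> are in \<open>R\<close>, so seminormality puts \<open>b * s\<close> into
  \<open>R\<close>.\<close>

lemma conductor_reduced_if_seminormal:
  assumes R: "is_subring R" and sn: "seminormal_ext R"
  shows "nucleus_reduced R"
proof -
  note I = conductor_submodule[OF R]
  have sq: "b \<in> conductor R" if b: "b * b \<in> conductor R" for b
  proof -
    have "b * s \<in> R" for s
    proof -
      have "(b * s) ^ 2 = (b * b) * (s * s)" "(b * s) ^ 3 = (b * b) * (b * s * s * s)"
        by (simp_all add: power2_eq_square power3_eq_cube ac_simps)
      then have "(b * s) ^ 2 \<in> R" "(b * s) ^ 3 \<in> R"
        using submodule_mult_right[OF I(1) UNIV_I b] I(2) by auto
      then show ?thesis using sn unfolding seminormal_ext_def by blast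
    qed
    from this this[of 1] show ?thesis by (simp add: conductor_def)
  qed
  have "r \<in> conductor R" if "r ^ Suc n \<in> conductor R" for r n
    using that
  proof (induction n)
    case (Suc n)
    \<comment> \<open>The square of \<open>r ^ Suc n\<close> is a multiple of the next power, so the
      exponent drops by one.\<close>
    have "r ^ Suc n * r ^ Suc n = r ^ Suc (Suc n) * r ^ n" by (simp add: algebra_simps)
    then have "r ^ Suc n \<in> conductor R"
      using sq submodule_mult_right[OF I(1) UNIV_I Suc.prems] by metis
    then show ?case by (rule Suc.IH)
  qed simp
  then show ?thesis
    unfolding nucleus_reduced_def reduced_quotient_def using gr0_implies_Suc by metis
qed

text \<open>The power \<open>(a * (1 - a * r)) ^ Suc n\<close> is a multiple of
  \<open>a ^ n * (1 - a * r)\<close>, so \<open>a * (1 - a * r)\<close> is nilpotent modulo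
  \<open>I\<close>.\<close>

lemma regular_mod_witness_if_reduced:
  assumes R: "is_subring R" and I: "submodule UNIV I" and red: "reduced_quotient R I"
    and ar: "a \<in> R" "r \<in> R" "a ^ n * (1 - a * r) \<in> I"
  shows "a - a * a * r \<in> I"
proof -
  have "(a - a * a * r) ^ Suc n = (a * (1 - a * r)) ^ Suc n"
    by (simp add: algebra_simps)
  also have "\<dots> = a ^ n * (1 - a * r) * (a * (1 - a * r) ^ n)"
    by (simp add: power_mult_distrib ac_simps)
  also have "\<dots> \<in> I" by (rule submodule_mult_right[OF I UNIV_I ar(3)])
  finally have "(a - a * a * r) ^ Suc n \<in> I" .
  moreover have "a - a * a * r \<in> R" using R ar by (intro subring_diff subring_mult)
  ultimately show ?thesis using red unfolding reduced_quotient_def by blast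
qed

text \<open>The ideals generated by \<open>I\<close> and the powers of \<open>a\<close> stabilise,
  so some \<open>a ^ N\<close> is a multiple of \<open>a ^ Suc N\<close> modulo
  \<open>I\<close>.\<close>

lemma regular_mod_if_artinian_reduced:
  assumes R: "is_subring R" and I: "submodule UNIV I" "I \<subseteq> R"
    and art: "artinian_quotient R I" and red: "reduced_quotient R I"
  shows "regular_mod R I"
  unfolding regular_mod_def
proof
  fix a assume a: "a \<in> R"
  define f where "f n = {i + r * a ^ n | i r. i \<in> I \<and> r \<in> R}" for n
  have f: "ideal_of R (f n) \<and> I \<subseteq> f n \<and> f (Suc n) \<subseteq> f n" for n
  proof (intro conjI)
    show "ideal_of R (f n)"
      unfolding ideal_of_iff
    proof
      show "submodule R (f n)"
        unfolding f_def by (rule submodule_adjoin[OF R submodule_antimono[OF I(1) subset_UNIV]])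
      show "f n \<subseteq> R"
        unfolding f_def using I(2) R a by (auto intro!: subring_add subring_mult subring_power)
    qed
    show "I \<subseteq> f n"
    proof
      fix i assume "i \<in> I"
      then show "i \<in> f n"
        unfolding f_def using subring_0[OF R] by (intro CollectI exI[of _ i] exI[of _ 0]) simp
    qed
    show "f (Suc n) \<subseteq> f n"
    proof
      fix x assume "x \<in> f (Suc n)"
      then obtain i r where *: "x = i + r * a ^ Suc n" "i \<in> I" "r \<in> R" by (auto simp: f_def)
      then show "x \<in> f n"
        unfolding f_def using subring_mult[OF R _ a]
        by (intro CollectI exI[of _ i] exI[of _ "r * a"]) (simp add: mult.assoc)
    qed
  qed
  then obtain N where "\<forall>n\<ge>N. f n = f N" using art unfolding artinian_quotient_def by blast
  then have "f (Suc N) = f N" using le_SucI by blast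
  moreover have "a ^ N \<in> f N"
    unfolding f_def using subring_1[OF R] submodule_0[OF I(1)]
    by (intro CollectI exI[of _ 0] exI[of _ 1]) simp
  ultimately have "a ^ N \<in> f (Suc N)" by simp
  then obtain i r where *: "a ^ N = i + r * a ^ Suc N" "i \<in> I" "r \<in> R" by (auto simp: f_def)
  have "a ^ N * (1 - a * r) = i"
    using *(1) by (simp add: algebra_simps)
  then have "a - a * a * r \<in> I"
    using *(2) by (intro regular_mod_witness_if_reduced[OF R I(1) red a *(3), of N]) simp
  then show "\<exists>b\<in>R. a - a * a * b \<in> I" using *(3) by blast
qed

text \<open>Choose \<open>e\<close> in \<open>P\<close> such that \<open>1 - e\<close> generates a
  minimal ideal modulo \<open>I\<close>. Joining to \<open>e\<close> an idempotent for the part of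
  \<open>p\<close> it misses cannot shrink that ideal, so nothing was missed.\<close>

lemma semisimple_mod_if_artinian_regular:
  assumes R: "is_subring R" and I: "submodule UNIV I" "I \<subseteq> R"
    and art: "artinian_quotient R I" and reg: "regular_mod R I"
  shows "semisimple_mod R I"
  unfolding semisimple_mod_def
proof (intro allI impI)
  fix P assume "submodule R P \<and> P \<subseteq> R \<and> I \<subseteq> P"
  then have P: "submodule R P" "P \<subseteq> R" "I \<subseteq> P" by auto
  define r where "r = {(L, J). ideal_of R L \<and> I \<subseteq> L \<and> ideal_of R J \<and> I \<subseteq> J \<and> L \<subset> J}"
  have "wf r"
    unfolding wf_iff_no_infinite_down_chain
  proof
    assume "\<exists>f. \<forall>i. (f (Suc i), f i) \<in> r"
    then obtain f where f: "\<And>i. (f (Suc i), f i) \<in> r" by blast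
    then have "\<forall>n. ideal_of R (f n) \<and> I \<subseteq> f n \<and> f (Suc n) \<subseteq> f n" by (auto simp: r_def)
    then obtain N where "\<forall>n\<ge>N. f n = f N" using art unfolding artinian_quotient_def by blast
    then have "f (Suc N) = f N" using le_SucI by blast
    then show False using f[of N] by (auto simp: r_def)
  qed
  define d where "d e = {i + s * (1 - e) | i s. i \<in> I \<and> s \<in> R}" for e
  have d: "ideal_of R (d e)" "I \<subseteq> d e" "1 - e \<in> d e" if "e \<in> P" for e
  proof -
    have e: "1 - e \<in> R" using that P(2) by (intro subring_diff[OF R] subring_1[OF R]) auto
    show "ideal_of R (d e)"
      unfolding ideal_of_iff
    proof
      show "submodule R (d e)"
        unfolding d_def by (rule submodule_adjoin[OF R submodule_antimono[OF I(1) subset_UNIV]])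
      show "d e \<subseteq> R" unfolding d_def using I(2) R e by (auto intro!: subring_add subring_mult)
    qed
    show "I \<subseteq> d e"
    proof
      fix i assume "i \<in> I"
      then show "i \<in> d e"
        unfolding d_def using subring_0[OF R] by (intro CollectI exI[of _ i] exI[of _ 0]) simp
    qed
    show "1 - e \<in> d e"
      unfolding d_def using subring_1[OF R] submodule_0[OF I(1)]
      by (intro CollectI exI[of _ 0] exI[of _ 1]) simp
  qed
  have "d 0 \<in> d ` P" using submodule_0[OF P(1)] by blast
  then obtain z where "z \<in> d ` P" "\<And>y. (y, z) \<in> r \<Longrightarrow> y \<notin> d ` P"
    using wfE_min[OF \<open>wf r\<close>] by metis
  then obtain e where e: "e \<in> P" and min: "\<And>e'. e' \<in> P \<Longrightarrow> (d e', d e) \<notin> r" by blast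
  have "p - p * e \<in> I" if p: "p \<in> P" for p
  proof -
    have "1 - e \<in> R" using e P(2) by (intro subring_diff[OF R] subring_1[OF R]) auto
    define q where "q = p * (1 - e)"
    have qP: "q \<in> P" unfolding q_def by (rule submodule_mult_right[OF P(1) \<open>1 - e \<in> R\<close> p])
    then obtain u where u: "u \<in> R" "q - q * q * u \<in> I" using reg P(2) unfolding regular_mod_def by blast
    define f where "f = q * u"
    have f: "f \<in> P" unfolding f_def by (rule submodule_mult_right[OF P(1) u(1) qP])
    define e' where "e' = e + f - e * f"
    have e'_eq: "1 - e' = (1 - f) * (1 - e)" by (simp add: e'_def algebra_simps)
    have "e * f \<in> P" using e f P by (intro submodule_mult[OF P(1)]) auto
    then have e': "e' \<in> P"
      unfolding e'_def by (intro submodule_diff[OF P(1)] submodule_add[OF P(1)] e f)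
    have "1 - f \<in> R" using f P(2) by (intro subring_diff[OF R] subring_1[OF R]) auto
    have "d e' \<subseteq> d e"
    proof
      fix x assume "x \<in> d e'"
      then obtain i s where *: "x = i + s * (1 - e')" "i \<in> I" "s \<in> R" by (auto simp: d_def)
      then show "x \<in> d e"
        unfolding d_def using subring_mult[OF R _ \<open>1 - f \<in> R\<close>]
        by (intro CollectI exI[of _ i] exI[of _ "s * (1 - f)"]) (simp add: e'_eq mult.assoc)
    qed
    then have "d e' = d e" using min[OF e'] d(1,2)[OF e'] d(1,2)[OF e] by (auto simp: r_def)
    then have "1 - e \<in> d e'" using d(3)[OF e] by simp
    \<comment> \<open>Multiplying by \<open>p\<close> turns the last term into
      \<open>s * q * (1 - f)\<close>, which lies in \<open>I\<close> by the choice of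
      \<open>u\<close>.\<close>
    then obtain i s where *: "1 - e = i + s * ((1 - f) * (1 - e))" "i \<in> I" by (auto simp: d_def e'_eq)
    have "p * (1 - e) = p * i + s * (q - q * q * u)"
      by (subst *(1)) (simp add: f_def q_def algebra_simps)
    also have "\<dots> \<in> I" by (intro submodule_add[OF I(1)] submodule_mult[OF I(1)] UNIV_I *(2) u(2))
    finally show ?thesis by (simp add: algebra_simps)
  qed
  then show "\<exists>e\<in>P. \<forall>p\<in>P. p - p * e \<in> I" using e by blast
qed

section \<open>The intermediate rings \<open>R + a S\<close> and the Artinian property of the
  nucleus\<close>

definition adjoin_multiples :: "'a::comm_ring_1 set \<Rightarrow> 'a \<Rightarrow> 'a set" where
  "adjoin_multiples R a = {r + a * s | r s. r \<in> R}"

lemma adjoin_multiplesI: "r \<in> R \<Longrightarrow> x = r + a * s \<Longrightarrow> x \<in> adjoin_multiples R a"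
  unfolding adjoin_multiples_def by blast

lemma adjoin_multiples_subring:
  assumes R: "is_subring R"
  shows "is_subring (adjoin_multiples R a)" "R \<subseteq> adjoin_multiples R a"
proof -
  show RW: "R \<subseteq> adjoin_multiples R a" by (auto intro: adjoin_multiplesI[where s=0])
  show "is_subring (adjoin_multiples R a)"
    unfolding is_subring_def
  proof (intro conjI ballI)
    show "0 \<in> adjoin_multiples R a" "1 \<in> adjoin_multiples R a" using RW subring_0[OF R] subring_1[OF R] by auto
    fix x y assume "x \<in> adjoin_multiples R a" "y \<in> adjoin_multiples R a"
    then obtain r s r' s' where *: "x = r + a * s" "y = r' + a * s'" "r \<in> R" "r' \<in> R"
      by (auto simp: adjoin_multiples_def)
    show "x + y \<in> adjoin_multiples R a"
      using subring_add[OF R *(3,4)] by (rule adjoin_multiplesI[where s="s + s'"]) (simp add: * algebra_simps)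
    show "x - y \<in> adjoin_multiples R a"
      using subring_diff[OF R *(3,4)] by (rule adjoin_multiplesI[where s="s - s'"]) (simp add: * algebra_simps)
    show "x * y \<in> adjoin_multiples R a"
      using subring_mult[OF R *(3,4)]
      by (rule adjoin_multiplesI[where s="r * s' + s * r' + a * s * s'"]) (simp add: * algebra_simps)
  qed
qed

lemma finite_adjoin_multiples:
  assumes "is_subring R" "fip_ext R"
  shows "finite (range (adjoin_multiples R))"
  using assms(2) adjoin_multiples_subring[OF assms(1)] unfolding fip_ext_def
  by (elim rev_finite_subset) auto

text \<open>Stabilisation gives \<open>a ^ n S \<subseteq> R + a (a ^ n S)\<close>. Nakayama's lemma
  for the ideal \<open>a R\<close>, applied modulo \<open>R\<close>, yields
  \<open>u = 1 - a * b\<close> with \<open>u a ^ n S \<subseteq> R\<close>, so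
  \<open>a ^ n * u\<close> is in the conductor.\<close>

lemma regular_mod_if_fip_finite_reduced:
  assumes R: "is_subring R" and fip: "fip_ext R" and fin: "finite_ext R" and red: "nucleus_reduced R"
  shows "regular_mod R (conductor R)"
  unfolding regular_mod_def
proof
  fix a assume a: "a \<in> R"
  note I = conductor_submodule[OF R]
  define T where "T n = adjoin_multiples R (a ^ n)" for n
  have dec: "T m \<subseteq> T n" if "n \<le> m" for n m
  proof
    fix x assume "x \<in> T m"
    then obtain r s where "x = r + a ^ m * s" "r \<in> R" by (auto simp: T_def adjoin_multiples_def)
    moreover have "a ^ m = a ^ n * a ^ (m - n)" using that by (simp flip: power_add)
    ultimately show "x \<in> T n"
      unfolding T_def by (intro adjoin_multiplesI[where s="a ^ (m - n) * s"]) (auto simp: mult.assoc)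
  qed
  have "finite (range T)"
    using finite_adjoin_multiples[OF R fip] by (rule rev_finite_subset) (auto simp: T_def)
  \<comment> \<open>Two members of the descending sequence coincide, and so do all members between
    them.\<close>
  then have "\<not> inj T" using finite_imageD infinite_UNIV_nat by blast
  then obtain n m where "n < m" "T n = T m"
    unfolding inj_def by (metis linorder_neqE_nat)
  then have T_eq: "T (Suc n) = T n" using dec[of n "Suc n"] dec[of "Suc n" m] by auto
  obtain F where F: "finite F" "gspan R (\<lambda>x. x) F {0} = UNIV"
    using fin unfolding finite_ext_iff_gspan by blast
  have span: "\<exists>c. (\<forall>j\<in>F. c j \<in> R) \<and> s = (\<Sum>j\<in>F. c j * j)" for s
  proof -
    have "s \<in> gspan R (\<lambda>x. x) F {0}" using F(2) by simp
    then show ?thesis by (elim gspanE) auto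
  qed
  define A where "A = {a * r | r. r \<in> R}"
  have A: "submodule R A"
    unfolding submodule_def
  proof (intro conjI ballI)
    show "0 \<in> A" unfolding A_def using subring_0[OF R] by (intro CollectI exI[of _ 0]) simp
  next
    fix x y assume "x \<in> A" "y \<in> A"
    then obtain r s where *: "x = a * r" "y = a * s" "r \<in> R" "s \<in> R" by (auto simp: A_def)
    have "x + y = a * (r + s)" "x - y = a * (r - s)" using * by (simp_all add: algebra_simps)
    then show "x + y \<in> A" "x - y \<in> A"
      unfolding A_def using subring_add[OF R *(3,4)] subring_diff[OF R *(3,4)] by blast+
  next
    fix t x assume "t \<in> R" "x \<in> A"
    then obtain r where *: "x = a * r" "r \<in> R" by (auto simp: A_def)
    have "t * x = a * (t * r)" using * by (simp add: ac_simps)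
    then show "t * x \<in> A" unfolding A_def using subring_mult[OF R \<open>t \<in> R\<close> *(2)] by blast
  qed
  have "A \<subseteq> R" unfolding A_def using subring_mult[OF R a] by auto
  have "\<exists>u. 1 - u \<in> A \<and> (\<forall>x\<in>F. u * (a ^ n * x) \<in> R)"
  proof (rule nakayama[OF R A \<open>A \<subseteq> R\<close> submodule_subring[OF R] F(1)])
    fix x assume "x \<in> F"
    have "a ^ n * x \<in> T n"
      unfolding T_def using subring_0[OF R] by (intro adjoin_multiplesI[where r=0 and s=x]) auto
    then have "a ^ n * x \<in> T (Suc n)" using T_eq by simp
    then obtain r s where *: "a ^ n * x = r + a ^ Suc n * s" "r \<in> R"
      by (auto simp: T_def adjoin_multiples_def)
    obtain c where c: "\<forall>j\<in>F. c j \<in> R" "s = (\<Sum>j\<in>F. c j * j)" using span by blast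
    have "(\<Sum>j\<in>F. a * c j * (a ^ n * j)) = a ^ Suc n * s"
      unfolding c(2) by (simp add: sum_distrib_left ac_simps)
    then have "1 * (a ^ n * x) - (\<Sum>j\<in>F. a * c j * (a ^ n * j)) \<in> R" using * by simp
    then show "\<exists>u c. 1 - u \<in> A \<and> (\<forall>j\<in>F. c j \<in> A) \<and> u * (a ^ n * x) - (\<Sum>j\<in>F. c j * (a ^ n * j)) \<in> R"
      using c(1) submodule_0[OF A] by (intro exI[of _ 1] exI[of _ "\<lambda>j. a * c j"]) (auto simp: A_def)
  qed
  then obtain u where u: "1 - u \<in> A" "\<And>x. x \<in> F \<Longrightarrow> u * (a ^ n * x) \<in> R" by blast
  obtain b where b: "1 - u = a * b" "b \<in> R" using u(1) by (auto simp: A_def)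
  have u_eq: "u = 1 - a * b" using b(1) by (simp add: algebra_simps)
  have "a ^ n * u * s \<in> R" for s
  proof -
    obtain c where c: "\<forall>j\<in>F. c j \<in> R" "s = (\<Sum>j\<in>F. c j * j)" using span by blast
    have "a ^ n * u * s = (\<Sum>j\<in>F. c j * (u * (a ^ n * j)))"
      unfolding c(2) by (simp add: sum_distrib_left ac_simps)
    also have "\<dots> \<in> R"
      by (rule submodule_sum[OF submodule_subring[OF R]], rule subring_mult[OF R]) (use c u in auto)
    finally show ?thesis .
  qed
  from this this[of 1] have "a ^ n * (1 - a * b) \<in> conductor R" by (simp add: conductor_def u_eq)
  then have "a - a * a * b \<in> conductor R"
    using regular_mod_witness_if_reduced[OF R I(1) _ a b(2)] red unfolding nucleus_reduced_def by blast
  then show "\<exists>b\<in>R. a - a * a * b \<in> conductor R" using b by blast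
qed

text \<open>An ideal above the conductor is determined by the rings \<open>R + a S\<close> with
  \<open>a\<close> in it, so FIP leaves finitely many such ideals.\<close>

lemma nucleus_artinian_if_fip_regular:
  assumes R: "is_subring R" and fip: "fip_ext R" and reg: "regular_mod R (conductor R)"
  shows "nucleus_artinian R"
proof -
  define I where "I = conductor R"
  note I = conductor_submodule[OF R, folded I_def]
  let ?W = "adjoin_multiples R"
  define X where "X = {J. ideal_of R J \<and> I \<subseteq> J}"
  have le: "J \<subseteq> K" if J: "J \<in> X" and K: "K \<in> X" and W: "?W ` J \<subseteq> ?W ` K" for J K
  proof
    fix a assume a: "a \<in> J"
    have JR: "J \<subseteq> R" and K': "submodule R K" "K \<subseteq> R" "I \<subseteq> K" using J K by (auto simp: X_def ideal_of_iff)
    obtain b where b: "b \<in> K" "?W a = ?W b" using W a by blast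
    obtain u where u: "u \<in> R" "b - b * b * u \<in> I" using reg b(1) K'(2) unfolding regular_mod_def I_def by blast
    \<comment> \<open>\<open>b * (1 - f)\<close> is in \<open>I\<close>, so
      \<open>a S \<subseteq> R + b S\<close> gives \<open>(1 - f) a S \<subseteq> R\<close>. Hence
      \<open>a\<close> agrees with \<open>a * f\<close> modulo \<open>I\<close> and lies in
      \<open>K\<close>.\<close>
    define f where "f = b * u"
    have f: "f \<in> K" unfolding f_def by (rule submodule_mult_right[OF K'(1) u(1) b(1)])
    have f1: "1 - f \<in> R" using f K'(2) by (intro subring_diff[OF R] subring_1[OF R]) auto
    have "a * (1 - f) * s \<in> R" for s
    proof -
      have "a * s \<in> ?W a" using subring_0[OF R] by (rule adjoin_multiplesI) simp
      then have "a * s \<in> ?W b" using b(2) by simp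
      then obtain r t where *: "a * s = r + b * t" "r \<in> R" by (auto simp: adjoin_multiples_def)
      have "a * (1 - f) * s = (1 - f) * (a * s)" by (simp add: ac_simps)
      also have "\<dots> = (1 - f) * r + (b - b * b * u) * t" unfolding *(1) by (simp add: f_def algebra_simps)
      also have "\<dots> \<in> R"
        using submodule_mult_right[OF I(1) UNIV_I u(2)] I(2)
        by (intro subring_add[OF R] subring_mult[OF R f1 *(2)]) auto
      finally show ?thesis .
    qed
    from this this[of 1] have "a * (1 - f) \<in> I" by (simp add: I_def conductor_def)
    moreover have "a * f \<in> K" using a JR f by (intro submodule_mult[OF K'(1)]) auto
    ultimately have "a * (1 - f) + a * f \<in> K"
      using K'(3) by (intro submodule_add[OF K'(1)]) auto
    then show "a \<in> K" by (simp add: algebra_simps)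
  qed
  have "inj_on (\<lambda>J. ?W ` J) X"
    using le by (intro inj_onI) blast
  moreover have "(\<lambda>J. ?W ` J) ` X \<subseteq> Pow (range ?W)" by auto
  ultimately have X: "finite X"
    using finite_adjoin_multiples[OF R fip] by (meson finite_Pow_iff finite_imageD finite_subset)
  show ?thesis
    unfolding nucleus_artinian_def artinian_quotient_def
  proof (intro allI impI)
    fix f :: "nat \<Rightarrow> 'a set"
    assume f: "\<forall>n. ideal_of R (f n) \<and> conductor R \<subseteq> f n \<and> f (Suc n) \<subseteq> f n"
    then have "finite (range f)" by (intro finite_subset[OF _ X]) (auto simp: X_def I_def)
    from finite_has_minimal[OF this]
    obtain N where N: "\<And>n. f n \<subseteq> f N \<Longrightarrow> f N = f n" by auto
    have "f n \<subseteq> f N" if "N \<le> n" for n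
      by (rule lift_Suc_antimono_le[of f, OF _ that]) (use f in blast)
    then show "\<exists>N. \<forall>n\<ge>N. f n = f N" using N by metis
  qed
qed

text \<open>A quasi-inverse \<open>d\<close> of \<open>b ^ 2\<close> approximates \<open>b\<close>
  by \<open>b ^ 3 * d\<close> in \<open>R\<close>. The error has its square in \<open>I\<close>, and
  regularity of \<open>S/I\<close> puts the error itself into \<open>I\<close>.\<close>

lemma seminormal_ext_if_regular:
  assumes R: "is_subring R" and I: "submodule UNIV I" "I \<subseteq> R"
    and reg: "regular_mod R I" "regular_mod UNIV I"
  shows "seminormal_ext R"
  unfolding seminormal_ext_def
proof (intro allI impI)
  fix b assume "b ^ 2 \<in> R \<and> b ^ 3 \<in> R"
  then have b: "b ^ 2 \<in> R" "b ^ 3 \<in> R" by auto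
  obtain d where d: "d \<in> R" "b ^ 2 - b ^ 2 * b ^ 2 * d \<in> I" using reg(1) b(1) unfolding regular_mod_def by blast
  define y where "y = b - b ^ 3 * d"
  have "y * y = (b ^ 2 - b ^ 2 * b ^ 2 * d) * (1 - b ^ 2 * d)"
    by (simp add: y_def power2_eq_square power3_eq_cube algebra_simps)
  then have yy: "y * y \<in> I" using submodule_mult_right[OF I(1) UNIV_I d(2)] by simp
  obtain s where "y - y * y * s \<in> I" using reg(2) unfolding regular_mod_def by blast
  then have "y \<in> I" using submodule_mem_cong[OF I(1) _ submodule_mult_right[OF I(1) UNIV_I yy]] by blast
  then have "y + b ^ 3 * d \<in> R"
    using I(2) by (intro subring_add[OF R] subring_mult[OF R b(2) d(1)]) auto
  then show "b \<in> R" by (simp add: y_def)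
qed

lemma etale_artinian_reduced:
  fixes R :: "'a::comm_ring_1 set"
  assumes R: "is_subring R" and et: "etale_ext R"
    and art: "nucleus_artinian R" and red: "nucleus_reduced R"
  shows "fip_ext R" "seminormal_ext R" "finite_ext R"
proof -
  note I = conductor_submodule[OF R]
  have reg: "regular_mod R (conductor R)"
    using regular_mod_if_artinian_reduced[OF R I] art red
    unfolding nucleus_artinian_def nucleus_reduced_def by blast
  have ss: "semisimple_mod R (conductor R)"
    using semisimple_mod_if_artinian_regular[OF R I _ reg] art unfolding nucleus_artinian_def by blast
  have sep: "separable_mod R (conductor R)"
    using et unfolding etale_ext_def
    by (intro separable_mod_if_unramified[OF R I] fg_algebra_if_fin_pres) auto
  show "fip_ext R" by (rule fip_ext_if_separable[OF R I ss sep])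
  show "finite_ext R" by (rule finite_ext_if_separable[OF R I ss sep])
  have "regular_mod UNIV (conductor R)"
    by (rule regular_mod_if_semisimple[OF subring_UNIV I(1) subset_UNIV
      semisimple_mod_if_separable[OF R I ss sep]])
  then show "seminormal_ext R" by (rule seminormal_ext_if_regular[OF R I reg])
qed

theorem theorem5p5:
  fixes R :: "'a::comm_ring_1 set"
  assumes "is_subring R" and "etale_ext R"
  shows "((fip_ext R \<and> seminormal_ext R \<and> finite_ext R) \<longleftrightarrow> (nucleus_artinian R \<and> nucleus_reduced R))
    \<and> ((fip_ext R \<and> finite_ext R \<and> nucleus_reduced R) \<longleftrightarrow> (seminormal_ext R \<and> gilmer_ext R))"
  \<comment> \<open>Seminormality reduces the nucleus; FIP, finiteness and a reduced nucleus make it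
    regular and then Artinian; an Artinian reduced nucleus returns FIP, seminormality and
    finiteness. Both equivalences follow propositionally.\<close>
  unfolding gilmer_ext_def
  using conductor_reduced_if_seminormal[OF assms(1)] etale_artinian_reduced[OF assms]
    nucleus_artinian_if_fip_regular[OF assms(1)] regular_mod_if_fip_finite_reduced[OF assms(1)]
  by blast

end
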